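(* Consider the stationary decision model with zero terminal cost described in the context. Assume the following. (1) There exist $\alpha,\underline\epsilon,\bar\epsilon\ge0$ with $\underline\epsilon+\bar\epsilon=1$ and measurable functions $\underline b:E\to(-\infty,-\underline\epsilon]$, $\bar b:E\to[\bar\epsilon,\infty)$ such that for all $(x,a)\in D$ $$\rho\big(c^-(x,a,T(x,a,Z))\big)\le-\underline b(x),\qquad \rho\big(-\underline b(T(x,a,Z))\big)\le-\alpha\underline b(x),$$ $$\rho\big(c^+(x,a,T(x,a,Z))\big)\le\bar b(x),\qquad \rho\big(\bar b(T(x,a,Z))\big)\le\alpha\bar b(x),$$ where $c^+,c^-\ge0$ are the positive and negative parts of $c$. (2) Put $b=\bar b-\underline b:E\to[1,\infty)$. For all $(\bar x,\bar a)\in D$ there exist $\epsilon>0$ and measurable $\Theta_1^{\bar x,\bar a},\Theta_2^{\bar x,\bar a}:\mathcal Z\to\mathbb R_+$ with $\Theta_1^{\bar x,\bar a}(Z),\Theta_2^{\bar x,\bar a}(Z)\in L^p$ and $|c(x,a,T(x,a,z))|\le\Theta_1^{\bar x,\bar a}(z)$, $b(T(x,a,z))\le\Theta_2^{\bar x,\bar a}(z)$ for all $z\in\mathcal Z$ and all $(x,a)\in D$ in the closed ball of radius $\epsilon$ around $(\bar x,\bar a)$ (w.r.t. a product metric on $E\times A$). (3) The risk measure $\rho:L^p\to\bar{\mathbb R}$ is law invariant, proper, coherent and has the Fatou property. (4) $\alpha\beta<1$. (5) The underlying probability space has the product structure $(\Omega,\mathcal A,\mathbb P)=\bigotimes_{n=1}^\infty(\Omega_1,\mathcal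 A_1,\mathbb P_1)$, with $Z_n(\omega)=Z_n(\omega_n)$ depending only on the component $\omega_n$ of $\omega=(\omega_1,\omega_2,\dots)$, and the probability measure $\mathbb P_1$ on $(\Omega_1,\mathcal A_1)$ is separable. Then for every $N\in\mathbb N\cup\{\infty\}$ and $x\in E$ $$J_N(x)=\inf_{\pi\in\Pi^M}\ \sup_{\mathbb Q\in\mathfrak Q_\pi}\ \mathbb E^{\mathbb Q}\Big[\sum_{k=0}^{N-1}\beta^kc\big(X_k,d_k(X_k),X_{k+1}\big)\Big],$$ where $\pi=(d_0,d_1,\dots)$ and $\mathfrak Q_\pi$ is the set of laws of motion with initial state $x$ defined in the context.
   Context: Risk measures. $(\Omega,\mathcal A,\mathbb P)$ is a probability space, $p\in[1,\infty)$, $q\in(1,\infty]$ with $\frac1p+\frac1q=1$; $L^p=L^p(\Omega,\mathcal A,\mathbb P)$. A risk measure is a map $\rho:L^p\to\bar{\mathbb R}=[-\infty,\infty]$. Monetary: monotone ($X\le Y\Rightarrow\rho(X)\le\rho(Y)$) and translation invariant ($\rho(X+m)=\rho(X)+m$, $m\in\mathbb R$). Coherent: monetary, positive homogeneous ($\rho(\lambda X)=\lambda\rho(X)$ for $\lambda\in\mathbb R_+$) and subadditive. Proper: never $-\infty$ and $<+\infty$ at at least one point. Law invariant: $\rho(X)=\rho(Y)$ whenever $X,Y$ have the same distribution. Fatou property: for $(X_n)\subseteq L^p$ with $|X_n|\le Y$ a.s., $Y\in L^p$, and $X_n\to X\in L^p$ a.s., $\liminf_n\rho(X_n)\ge\rho(X)$.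 Dual representation (known). Let $\mathcal M_1^q(\Omega,\mathcal A,\mathbb P)$ be the set of probability measures $\mathbb Q\ll\mathbb P$ with $\frac{d\mathbb Q}{d\mathbb P}\in L^q$. For $\rho$ proper, coherent with the Fatou property there is a $\sigma(L^q,L^p)$-compact set $\mathcal Q\subseteq\mathcal M_1^q(\Omega,\mathcal A,\mathbb P)$ (measures identified with densities) with $\rho(X)=\max_{\mathbb Q\in\mathcal Q}\mathbb E^{\mathbb Q}[X]$ for $X\in L^p$; fix such a $\mathcal Q$, equipped with the Borel $\sigma$-algebra of $\sigma(L^q,L^p)$. Separability of $\mathbb P_1$ means that $\mathcal A_1$ with the pseudometric $(A,B)\mapsto\mathbb P_1(A\triangle B)$ is separable. Stationary decision model. State space $E$ and action space $A$ are Borel spaces (Borel subsets of Polish spaces); $D\subseteq E\times A$ is measurable and contains the graph of a measurable map $E\to A$; $D(x)=\{a:(x,a)\in D\}$; $T:D\times\mathcal Z\to E$ is a measurable transition function; the disturbances $Z_1,Z_2,\dots$ are i.i.d. random elements on $(\Omega,\mathcal A,\mathbb P)$ with values in a measurable space $(\mathcal Z,\mathfrak Z)$, and $Z$ denotes a representative; $c:D\times E\to\mathbb R$ is the (measurable) one-stage cost; $\beta\in(0,1]$ is the discount factor. A Markov decision rule is a measurable $d:E\to A$ with $d(x)\in D(x)$; $\Pi^M$ is the set of Markov policies $\pi=(d_0,d_1,\dots)$. Values. For a Markov decision rule $d$ and $v:E\to\mathbb R$ measurable with $|v|\le\lambda b$ for some $\lambda\in\mathbb R_+$, $\mathcal T_dv(x)=\rho\big(c(x,d(x),T(x,d(x),Z))+\beta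 v(T(x,d(x),Z))\big)$. $J_{N\pi}=\mathcal T_{d_0}\circ\dots\circ\mathcal T_{d_{N-1}}0$ for $N\in\mathbb N$, $J_{\infty\pi}=\lim_{N\to\infty}J_{N\pi}$ (the limit exists pointwise), and $J_N(x)=\inf_{\pi\in\Pi^M}J_{N\pi}(x)$ for $N\in\mathbb N\cup\{\infty\}$. It is assumed throughout that all policy values $J_{N\pi}$ are measurable. Laws of motion. Let $\Gamma$ be the set of sequences $\gamma=(\gamma_0,\gamma_1,\dots)$ of measurable maps $\gamma_n:D\to\mathcal Q$; write $\gamma_n(d\omega|x,a)$ for the measure $\gamma_n(x,a)$. For $\pi=(d_0,d_1,\dots)\in\Pi^M$ and $\gamma\in\Gamma$ define the transition kernels $Q_n^{\pi\gamma}(B|x)=\int\mathbb 1_B\big(T(x,d_n(x),Z(\omega))\big)\,\gamma_n(d\omega|x,d_n(x))$, $B\in\mathcal B(E)$, $x\in E$, and, on $E^\infty$, the law $\mathbb Q_x^{\pi\gamma}=\delta_x\otimes Q_0^{\pi\gamma}\otimes Q_1^{\pi\gamma}\otimes\cdots$. Then $\mathfrak Q_\pi=\{\mathbb Q_x^{\pi\gamma}:\gamma\in\Gamma\}$, and $X_0,X_1,\dots$ are the coordinate maps on $E^\infty$. *)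

theory Defs
  imports "HOL-Probability.Probability"
begin

text \<open>
  Elements of $L^r$ are represented by functions instead of almost-everywhere classes. The
  exponent is extended real, with essentially bounded functions for \<open>r = \<infinity>\<close>.
\<close>

definition Lp_space :: "'o measure \<Rightarrow> ereal \<Rightarrow> ('o \<Rightarrow> real) set" where
  "Lp_space M r = {X \<in> borel_measurable M.
     if r = \<infinity> then \<exists>C. AE \<omega> in M. \<bar>X \<omega>\<bar> \<le> C
     else integrable M (\<lambda>\<omega>. \<bar>X \<omega>\<bar> powr real_of_ereal r)}"

text \<open>
  A risk measure is a function \<open>\<rho> :: ('o \<Rightarrow> real) \<Rightarrow> ereal\<close>; only its values on \<open>Lp_space M p\<close>
  matter. The order of $L^p$ is the almost sure one, so \<open>rm_monotone\<close> also makes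
  \<open>\<rho>\<close> well defined on classes.
\<close>

definition rm_monotone :: "'o measure \<Rightarrow> ereal \<Rightarrow> (('o \<Rightarrow> real) \<Rightarrow> ereal) \<Rightarrow> bool" where
  "rm_monotone M p \<rho> \<longleftrightarrow>
     (\<forall>X\<in>Lp_space M p. \<forall>Y\<in>Lp_space M p. (AE \<omega> in M. X \<omega> \<le> Y \<omega>) \<longrightarrow> \<rho> X \<le> \<rho> Y)"

definition rm_translation_invariant ::
  "'o measure \<Rightarrow> ereal \<Rightarrow> (('o \<Rightarrow> real) \<Rightarrow> ereal) \<Rightarrow> bool" where
  "rm_translation_invariant M p \<rho> \<longleftrightarrow>
     (\<forall>X\<in>Lp_space M p. \<forall>m::real. \<rho> (\<lambda>\<omega>. X \<omega> + m) = \<rho> X + ereal m)"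

definition rm_monetary :: "'o measure \<Rightarrow> ereal \<Rightarrow> (('o \<Rightarrow> real) \<Rightarrow> ereal) \<Rightarrow> bool" where
  "rm_monetary M p \<rho> \<longleftrightarrow> rm_monotone M p \<rho> \<and> rm_translation_invariant M p \<rho>"

definition rm_positive_homogeneous ::
  "'o measure \<Rightarrow> ereal \<Rightarrow> (('o \<Rightarrow> real) \<Rightarrow> ereal) \<Rightarrow> bool" where
  "rm_positive_homogeneous M p \<rho> \<longleftrightarrow>
     (\<forall>X\<in>Lp_space M p. \<forall>l::real. 0 \<le> l \<longrightarrow> \<rho> (\<lambda>\<omega>. l * X \<omega>) = ereal l * \<rho> X)"

definition rm_subadditive :: "'o measure \<Rightarrow> ereal \<Rightarrow> (('o \<Rightarrow> real) \<Rightarrow> ereal) \<Rightarrow> bool" where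
  "rm_subadditive M p \<rho> \<longleftrightarrow>
     (\<forall>X\<in>Lp_space M p. \<forall>Y\<in>Lp_space M p. \<rho> (\<lambda>\<omega>. X \<omega> + Y \<omega>) \<le> \<rho> X + \<rho> Y)"

definition rm_coherent :: "'o measure \<Rightarrow> ereal \<Rightarrow> (('o \<Rightarrow> real) \<Rightarrow> ereal) \<Rightarrow> bool" where
  "rm_coherent M p \<rho> \<longleftrightarrow>
     rm_monetary M p \<rho> \<and> rm_positive_homogeneous M p \<rho> \<and> rm_subadditive M p \<rho>"

definition rm_proper :: "'o measure \<Rightarrow> ereal \<Rightarrow> (('o \<Rightarrow> real) \<Rightarrow> ereal) \<Rightarrow> bool" where
  "rm_proper M p \<rho> \<longleftrightarrow>
     (\<forall>X\<in>Lp_space M p. \<rho> X \<noteq> -\<infinity>) \<and> (\<exists>X\<in>Lp_space M p. \<rho> X < \<infinity>)"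

definition rm_law_invariant :: "'o measure \<Rightarrow> ereal \<Rightarrow> (('o \<Rightarrow> real) \<Rightarrow> ereal) \<Rightarrow> bool" where
  "rm_law_invariant M p \<rho> \<longleftrightarrow>
     (\<forall>X\<in>Lp_space M p. \<forall>Y\<in>Lp_space M p. distr M borel X = distr M borel Y \<longrightarrow> \<rho> X = \<rho> Y)"

definition rm_fatou :: "'o measure \<Rightarrow> ereal \<Rightarrow> (('o \<Rightarrow> real) \<Rightarrow> ereal) \<Rightarrow> bool" where
  "rm_fatou M p \<rho> \<longleftrightarrow>
     (\<forall>(Xs :: nat \<Rightarrow> 'o \<Rightarrow> real) X Y.
        (\<forall>n. Xs n \<in> Lp_space M p) \<and> X \<in> Lp_space M p \<and> Y \<in> Lp_space M p \<and>
        (\<forall>n. AE \<omega> in M. \<bar>Xs n \<omega>\<bar> \<le> Y \<omega>) \<and> (AE \<omega> in M. (\<lambda>n. Xs n \<omega>) \<longlonglongrightarrow> X \<omega>) \<longrightarrow>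
        \<rho> X \<le> liminf (\<lambda>n. \<rho> (Xs n)))"

definition dual_density :: "'o measure \<Rightarrow> 'o measure \<Rightarrow> 'o \<Rightarrow> real" where
  "dual_density M Q = (\<lambda>\<omega>. enn2real (RN_deriv M Q \<omega>))"

definition prob_measures_dual :: "'o measure \<Rightarrow> ereal \<Rightarrow> 'o measure set" where
  "prob_measures_dual M q = {Q. prob_space Q \<and> sets Q = sets M \<and> absolutely_continuous M Q \<and>
     dual_density M Q \<in> Lp_space M q}"

definition weak_topology_Lp :: "'o measure \<Rightarrow> ereal \<Rightarrow> ereal \<Rightarrow> ('o \<Rightarrow> real) topology" where
  "weak_topology_Lp M q p = topology_generated_by
     {{Y \<in> Lp_space M q. (\<integral>\<omega>. X \<omega> * Y \<omega> \<partial>M) \<in> U} | X U. X \<in> Lp_space M p \<and> open U}"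

text \<open>The topology $\sigma(L^q,L^p)$ on measures, which are identified with their densities.\<close>

definition weak_topology_measures :: "'o measure \<Rightarrow> ereal \<Rightarrow> ereal \<Rightarrow> 'o measure topology" where
  "weak_topology_measures M q p =
     pullback_topology (prob_measures_dual M q) (dual_density M) (weak_topology_Lp M q p)"

definition dual_representation ::
  "'o measure \<Rightarrow> ereal \<Rightarrow> ereal \<Rightarrow> (('o \<Rightarrow> real) \<Rightarrow> ereal) \<Rightarrow> 'o measure set \<Rightarrow> bool" where
  "dual_representation M p q \<rho> \<Q> \<longleftrightarrow>
     \<Q> \<subseteq> prob_measures_dual M q \<and> compactin (weak_topology_measures M q p) \<Q> \<and>
     (\<forall>X\<in>Lp_space M p. (\<forall>Q\<in>\<Q>. ereal (\<integral>\<omega>. X \<omega> \<partial>Q) \<le> \<rho> X) \<and>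
                       (\<exists>Q\<in>\<Q>. \<rho> X = ereal (\<integral>\<omega>. X \<omega> \<partial>Q)))"

definition dual_borel :: "'o measure \<Rightarrow> ereal \<Rightarrow> ereal \<Rightarrow> 'o measure set \<Rightarrow> 'o measure measure" where
  "dual_borel M p q \<Q> = sigma \<Q> {U. openin (subtopology (weak_topology_measures M q p) \<Q>) U}"

definition separable_measure :: "'w measure \<Rightarrow> bool" where
  "separable_measure P1 \<longleftrightarrow> (\<exists>\<C>. countable \<C> \<and> \<C> \<subseteq> sets P1 \<and>
     (\<forall>A\<in>sets P1. \<forall>\<epsilon>>0. \<exists>C\<in>\<C>. measure P1 (sym_diff A C) < \<epsilon>))"

definition markov_rules ::
  "'e::topological_space set \<Rightarrow> 'a::topological_space set \<Rightarrow> ('e \<times> 'a) set \<Rightarrow> ('e \<Rightarrow> 'a) set" where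
  "markov_rules E A D =
     {d \<in> restrict_space borel E \<rightarrow>\<^sub>M restrict_space borel A. \<forall>x\<in>E. (x, d x) \<in> D}"

definition markov_policies ::
  "'e::topological_space set \<Rightarrow> 'a::topological_space set \<Rightarrow> ('e \<times> 'a) set \<Rightarrow>
     (nat \<Rightarrow> 'e \<Rightarrow> 'a) set" where
  "markov_policies E A D = {\<pi>. \<forall>n. \<pi> n \<in> markov_rules E A D}"

text \<open>
  The operator $\mathcal T_d$. It returns values of \<open>\<rho>\<close>, hence extended reals, and is
  iterated on its own results, so it reads its argument \<open>v\<close> back through \<open>real_of_ereal\<close>.
  This is meant for finite \<open>v\<close> only; a bound \<open>\<bar>v\<bar> \<le> \<lambda> * b\<close> is preserved up to the value
  of \<open>\<lambda>\<close> under the integrability and growth conditions on the model.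
\<close>

definition policy_operator ::
  "(('o \<Rightarrow> real) \<Rightarrow> ereal) \<Rightarrow> ('e \<Rightarrow> 'a \<Rightarrow> 'e \<Rightarrow> real) \<Rightarrow> ('e \<Rightarrow> 'a \<Rightarrow> 'z \<Rightarrow> 'e) \<Rightarrow> ('o \<Rightarrow> 'z) \<Rightarrow>
     real \<Rightarrow> ('e \<Rightarrow> 'a) \<Rightarrow> ('e \<Rightarrow> ereal) \<Rightarrow> 'e \<Rightarrow> ereal" where
  "policy_operator \<rho> c T Z \<beta> d v x =
     \<rho> (\<lambda>\<omega>. c x (d x) (T x (d x) (Z \<omega>)) + \<beta> * real_of_ereal (v (T x (d x) (Z \<omega>))))"

definition finite_policy_value ::
  "(('o \<Rightarrow> real) \<Rightarrow> ereal) \<Rightarrow> ('e \<Rightarrow> 'a \<Rightarrow> 'e \<Rightarrow> real) \<Rightarrow> ('e \<Rightarrow> 'a \<Rightarrow> 'z \<Rightarrow> 'e) \<Rightarrow> ('o \<Rightarrow> 'z) \<Rightarrow>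
     real \<Rightarrow> nat \<Rightarrow> (nat \<Rightarrow> 'e \<Rightarrow> 'a) \<Rightarrow> 'e \<Rightarrow> ereal" where
  "finite_policy_value \<rho> c T Z \<beta> N \<pi> =
     foldr (\<lambda>n. policy_operator \<rho> c T Z \<beta> (\<pi> n)) [0..<N] (\<lambda>_. 0)"

definition policy_value ::
  "(('o \<Rightarrow> real) \<Rightarrow> ereal) \<Rightarrow> ('e \<Rightarrow> 'a \<Rightarrow> 'e \<Rightarrow> real) \<Rightarrow> ('e \<Rightarrow> 'a \<Rightarrow> 'z \<Rightarrow> 'e) \<Rightarrow> ('o \<Rightarrow> 'z) \<Rightarrow>
     real \<Rightarrow> enat \<Rightarrow> (nat \<Rightarrow> 'e \<Rightarrow> 'a) \<Rightarrow> 'e \<Rightarrow> ereal" where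
  "policy_value \<rho> c T Z \<beta> N \<pi> x =
     (case N of enat n \<Rightarrow> finite_policy_value \<rho> c T Z \<beta> n \<pi> x
              | \<infinity> \<Rightarrow> lim (\<lambda>n. finite_policy_value \<rho> c T Z \<beta> n \<pi> x))"

definition optimal_value ::
  "(('o \<Rightarrow> real) \<Rightarrow> ereal) \<Rightarrow> ('e \<Rightarrow> 'a \<Rightarrow> 'e \<Rightarrow> real) \<Rightarrow> ('e \<Rightarrow> 'a \<Rightarrow> 'z \<Rightarrow> 'e) \<Rightarrow> ('o \<Rightarrow> 'z) \<Rightarrow>
     real \<Rightarrow> (nat \<Rightarrow> 'e \<Rightarrow> 'a) set \<Rightarrow> enat \<Rightarrow> 'e \<Rightarrow> ereal" where
  "optimal_value \<rho> c T Z \<beta> policies N x = (INF \<pi>\<in>policies. policy_value \<rho> c T Z \<beta> N \<pi> x)"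

definition nature_policies ::
  "('e::topological_space \<times> 'a::topological_space) set \<Rightarrow> 'o measure measure \<Rightarrow>
     (nat \<Rightarrow> 'e \<times> 'a \<Rightarrow> 'o measure) set" where
  "nature_policies D BQ = {\<gamma>. \<forall>n. \<gamma> n \<in> restrict_space borel D \<rightarrow>\<^sub>M BQ}"

text \<open>
  The kernel $Q_n^{\pi\gamma}(\cdot\mid x)$ is the image of $\gamma_n(\cdot\mid x,d_n(x))$ under
  \<open>\<lambda>\<omega>. T x (d\<^sub>n x) (Z \<omega>)\<close>.
\<close>

definition transition_kernel ::
  "'e::topological_space set \<Rightarrow> ('e \<Rightarrow> 'a \<Rightarrow> 'z \<Rightarrow> 'e) \<Rightarrow> ('o \<Rightarrow> 'z) \<Rightarrow> (nat \<Rightarrow> 'e \<Rightarrow> 'a) \<Rightarrow>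
     (nat \<Rightarrow> 'e \<times> 'a \<Rightarrow> 'o measure) \<Rightarrow> nat \<Rightarrow> 'e \<Rightarrow> 'e measure" where
  "transition_kernel E T Z \<pi> \<gamma> n x =
     distr (\<gamma> n (x, \<pi> n x)) (restrict_space borel E) (\<lambda>\<omega>. T x (\<pi> n x) (Z \<omega>))"

text \<open>
  The kernels of the coordinate process given its past, in the format of the Ionescu-Tulcea
  theorem: \<open>path_kernel \<dots> n h\<close> is the conditional law of \<open>X\<^sub>n\<close> given
  \<open>(X\<^sub>0, \<dots>, X\<^sub>n\<^sub>-\<^sub>1) = h\<close>.
\<close>

definition path_kernel ::
  "'e::topological_space set \<Rightarrow> ('e \<Rightarrow> 'a \<Rightarrow> 'z \<Rightarrow> 'e) \<Rightarrow> ('o \<Rightarrow> 'z) \<Rightarrow> (nat \<Rightarrow> 'e \<Rightarrow> 'a) \<Rightarrow>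
     (nat \<Rightarrow> 'e \<times> 'a \<Rightarrow> 'o measure) \<Rightarrow> 'e \<Rightarrow> nat \<Rightarrow> (nat \<Rightarrow> 'e) \<Rightarrow> 'e measure" where
  "path_kernel E T Z \<pi> \<gamma> x n h =
     (case n of 0 \<Rightarrow> return (restrict_space borel E) x
              | Suc k \<Rightarrow> transition_kernel E T Z \<pi> \<gamma> k (h k))"

text \<open>
  $\delta_x\otimes Q_0^{\pi\gamma}\otimes Q_1^{\pi\gamma}\otimes\cdots$ on $E^\infty$, as the
  projective limit from the locale \<open>Ionescu_Tulcea\<close>; \<open>law_of_motion_finite_dim\<close>
  states its finite-dimensional distributions.
\<close>

definition law_of_motion ::
  "'e::topological_space set \<Rightarrow> ('e \<Rightarrow> 'a \<Rightarrow> 'z \<Rightarrow> 'e) \<Rightarrow> ('o \<Rightarrow> 'z) \<Rightarrow> (nat \<Rightarrow> 'e \<Rightarrow> 'a) \<Rightarrow>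
     (nat \<Rightarrow> 'e \<times> 'a \<Rightarrow> 'o measure) \<Rightarrow> 'e \<Rightarrow> (nat \<Rightarrow> 'e) measure" where
  "law_of_motion E T Z \<pi> \<gamma> x =
     projective_family.lim UNIV
       (Ionescu_Tulcea.CI (path_kernel E T Z \<pi> \<gamma> x) (\<lambda>_. restrict_space borel E))
       (\<lambda>_. restrict_space borel E)"

lemma law_of_motion_finite_dim:
  fixes E :: "'e::topological_space set"
  defines "B \<equiv> restrict_space borel E"
  assumes "Ionescu_Tulcea (path_kernel E T Z \<pi> \<gamma> x) (\<lambda>_. B)"
  shows "distr (law_of_motion E T Z \<pi> \<gamma> x) (PiM {0..<n} (\<lambda>_. B)) (\<lambda>X. restrict X {0..<n}) =
         Ionescu_Tulcea.C (path_kernel E T Z \<pi> \<gamma> x) (\<lambda>_. B) 0 n (\<lambda>_. undefined)"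
proof -
  interpret IT: Ionescu_Tulcea "path_kernel E T Z \<pi> \<gamma> x" "\<lambda>_. B" by fact
  have u: "IT.up_to {0..<n} \<le> n" by (simp add: IT.up_to_iff)
  moreover have "n \<le> IT.up_to {0..<n}"
    using IT.up_to_less[of "{0..<n}" "n - 1"] by (cases n) auto
  ultimately have n: "IT.up_to {0..<n} = n" by simp
  have "distr (IT.C 0 n (\<lambda>_. undefined)) (PiM {0..<n} (\<lambda>_. B)) (\<lambda>f. restrict f {0..<n}) =
        IT.C 0 n (\<lambda>_. undefined)"
    using IT.distr_C[of n n "\<lambda>_. undefined" 0] by simp
  then have "IT.CI {0..<n} = IT.C 0 n (\<lambda>_. undefined)"
    by (simp add: IT.CI_def n)
  then show ?thesis
    using IT.distr_lim[of "{0..<n}"] by (simp add: law_of_motion_def B_def)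
qed

definition laws_of_motion ::
  "'e::topological_space set \<Rightarrow> ('e \<Rightarrow> 'a \<Rightarrow> 'z \<Rightarrow> 'e) \<Rightarrow> ('o \<Rightarrow> 'z) \<Rightarrow>
     (nat \<Rightarrow> 'e \<times> 'a \<Rightarrow> 'o measure) set \<Rightarrow> (nat \<Rightarrow> 'e \<Rightarrow> 'a) \<Rightarrow> 'e \<Rightarrow> (nat \<Rightarrow> 'e) measure set" where
  "laws_of_motion E T Z \<Gamma> \<pi> x = (\<lambda>\<gamma>. law_of_motion E T Z \<pi> \<gamma> x) ` \<Gamma>"

definition discounted_cost ::
  "('e \<Rightarrow> 'a \<Rightarrow> 'e \<Rightarrow> real) \<Rightarrow> real \<Rightarrow> enat \<Rightarrow> (nat \<Rightarrow> 'e \<Rightarrow> 'a) \<Rightarrow> (nat \<Rightarrow> 'e) \<Rightarrow> real" where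
  "discounted_cost c \<beta> N \<pi> X =
     (case N of enat n \<Rightarrow> (\<Sum>k<n. \<beta> ^ k * c (X k) (\<pi> k (X k)) (X (Suc k)))
              | \<infinity> \<Rightarrow> (\<Sum>k. \<beta> ^ k * c (X k) (\<pi> k (X k)) (X (Suc k))))"

end

theory Submission
  imports Defs
begin

text \<open>
  The equality holds policy by policy. Nature's value of a policy telescopes along the path: by the
  dual representation the one-step expectation under any \<open>\<gamma>\<^sub>n\<close> is at most the next value of
  $\mathcal T_{d_n}$, which gives one inequality. For the other one, no measurable selection
  theorem is needed. By compactness of \<open>\<Q>\<close> and Dini's argument, dominated convergence is uniform
  over \<open>\<Q>\<close>; separability of the law of \<open>Z\<close> then makes every risk \<open>\<rho> (f \<circ> Z)\<close> the supremum over one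
  countable subset of \<open>\<Q>\<close>, and choosing its first \<open>\<epsilon>\<close>-optimal element is measurable in the
  state-action pair. For the infinite horizon, the expected cost after time \<open>N\<close> is at most
  $(\alpha\beta)^N b(x)/(1-\alpha\beta)$ uniformly in \<open>\<gamma>\<close>.
\<close>

section \<open>Representing sets of measures\<close>

text \<open>The obstacle is measurability: the dual representation supplies a maximising measure for
  each state-action pair separately, while nature has to choose measurably in the pair, with respect
  to the weak Borel sets of \<open>\<Q>\<close>. The way out is that the dynamics see \<omega>
  through \<open>Z \<omega>\<close> alone. So only random variables \<open>f (Z \<omega>)\<close>
  must be controlled, and the law of \<open>Z\<close> inherits separability because it is an image
  of \<open>P1\<close>. Almost optimal choices are enough, since the errors of finitely many steps
  add up to a prescribed amount.

  The four risk bounds act as integral bounds under every \<open>Q \<in> \<Q>\<close>: with b = bup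
  - blo, the integral of |c| is at most b, and that of b after one transition at most \<alpha> b.
  Hence E b(X_n) \<le> \<alpha>^n b(x) for every choice of nature. Bounds |v| \<le> C b then
  reproduce under backward induction for C = 1/(1 - \<alpha> \<beta>), the fixed point of C = 1 +
  \<alpha> \<beta> C. They also give the finiteness and integrability without which
  \<open>real_of_ereal\<close> and the Bochner integral would return meaningless default
  values.\<close>

lemma Lp_space_ereal_iff:
  "X \<in> Lp_space M (ereal p) \<longleftrightarrow>
     X \<in> borel_measurable M \<and> integrable M (\<lambda>\<omega>. \<bar>X \<omega>\<bar> powr p)"
  by (simp add: Lp_space_def)

lemma Lp_space_measurable: "X \<in> Lp_space M r \<Longrightarrow> X \<in> borel_measurable M"
  by (simp add: Lp_space_def)

lemma Lp_space_dominated: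
  assumes Y: "Y \<in> Lp_space M (ereal p)" and p: "0 \<le> p" and [measurable]: "X \<in> borel_measurable M"
    and le: "\<And>\<omega>. \<omega> \<in> space M \<Longrightarrow> \<bar>X \<omega>\<bar> \<le> \<bar>Y \<omega>\<bar>"
  shows "X \<in> Lp_space M (ereal p)"
proof -
  have "integrable M (\<lambda>\<omega>. \<bar>X \<omega>\<bar> powr p)"
  proof (rule Bochner_Integration.integrable_bound)
    show "integrable M (\<lambda>\<omega>. \<bar>Y \<omega>\<bar> powr p)"
      using Y by (simp add: Lp_space_ereal_iff)
    show "AE \<omega> in M. norm (\<bar>X \<omega>\<bar> powr p) \<le> norm (\<bar>Y \<omega>\<bar> powr p)"
      using le p by (auto intro!: AE_I2 powr_mono2)
  qed measurable
  then show ?thesis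
    by (simp add: Lp_space_ereal_iff)
qed

lemma Lp_space_cmult:
  assumes "X \<in> Lp_space M (ereal p)" and p: "0 \<le> p"
  shows "(\<lambda>\<omega>. k * X \<omega>) \<in> Lp_space M (ereal p)"
  using assms by (auto simp: Lp_space_ereal_iff abs_mult powr_mult)

lemma Lp_space_abs:
  "X \<in> Lp_space M (ereal p) \<Longrightarrow> (\<lambda>\<omega>. \<bar>X \<omega>\<bar>) \<in> Lp_space M (ereal p)"
  by (auto simp: Lp_space_ereal_iff)

lemma Lp_space_add:
  assumes X: "X \<in> Lp_space M (ereal p)" and Y: "Y \<in> Lp_space M (ereal p)" and p: "0 \<le> p"
  shows "(\<lambda>\<omega>. X \<omega> + Y \<omega>) \<in> Lp_space M (ereal p)"
proof -
  have [measurable]: "X \<in> borel_measurable M" "Y \<in> borel_measurable M"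
    using X Y by (auto simp: Lp_space_measurable)
  have "integrable M (\<lambda>\<omega>. \<bar>X \<omega> + Y \<omega>\<bar> powr p)"
  proof (rule Bochner_Integration.integrable_bound)
    \<comment> \<open>The constant comes from |X + Y| \<le> 2 max(|X|, |Y|) and monotonicity of the
      power.\<close>
    show "integrable M (\<lambda>\<omega>. 2 powr p * (\<bar>X \<omega>\<bar> powr p + \<bar>Y \<omega>\<bar> powr p))"
      using X Y by (auto simp: Lp_space_ereal_iff)
    show "AE \<omega> in M. norm (\<bar>X \<omega> + Y \<omega>\<bar> powr p) \<le>
        norm (2 powr p * (\<bar>X \<omega>\<bar> powr p + \<bar>Y \<omega>\<bar> powr p))"
    proof (rule AE_I2)
      fix \<omega>
      have "\<bar>X \<omega> + Y \<omega>\<bar> powr p \<le> (2 * max \<bar>X \<omega>\<bar> \<bar>Y \<omega>\<bar>) powr p"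
        using p by (intro powr_mono2) auto
      also have "\<dots> = 2 powr p * (max \<bar>X \<omega>\<bar> \<bar>Y \<omega>\<bar>) powr p"
        by (simp add: powr_mult)
      also have "\<dots> \<le> 2 powr p * (\<bar>X \<omega>\<bar> powr p + \<bar>Y \<omega>\<bar> powr p)"
        by (intro mult_left_mono) (auto simp: max_def)
      finally show "norm (\<bar>X \<omega> + Y \<omega>\<bar> powr p) \<le>
          norm (2 powr p * (\<bar>X \<omega>\<bar> powr p + \<bar>Y \<omega>\<bar> powr p))"
        by simp
    qed
  qed measurable
  then show ?thesis
    by (simp add: Lp_space_ereal_iff)
qed

lemma Lp_space_diff:
  assumes "X \<in> Lp_space M (ereal p)" "Y \<in> Lp_space M (ereal p)" "0 \<le> p"
  shows "(\<lambda>\<omega>. X \<omega> - Y \<omega>) \<in> Lp_space M (ereal p)"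
  using Lp_space_add[OF assms(1) Lp_space_cmult[OF assms(2), of "-1"]] assms by simp

lemma Lp_space_bounded:
  assumes "finite_measure M" "0 \<le> p" "X \<in> borel_measurable M"
    and "\<And>\<omega>. \<omega> \<in> space M \<Longrightarrow> \<bar>X \<omega>\<bar> \<le> C"
  shows "X \<in> Lp_space M (ereal p)"
proof -
  have "(\<lambda>_. C) \<in> Lp_space M (ereal p)"
    using assms(1) by (simp add: Lp_space_ereal_iff finite_measure.integrable_const)
  then show ?thesis
    by (rule Lp_space_dominated) (use assms in \<open>simp_all add: order_trans[OF _ abs_ge_self]\<close>)
qed

text \<open>Hoelder's inequality reduced to integrability, for which Young's inequality pointwise
  suffices. An infinite \<open>q\<close> forces p = 1, and then an essential bound of
  \<open>Y\<close> does the work.\<close>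

lemma Lp_space_mult_integrable:
  assumes p: "1 \<le> p" and q: "1 < q" and pq: "1 / ereal p + 1 / q = 1"
    and X: "X \<in> Lp_space M (ereal p)" and Y: "Y \<in> Lp_space M q"
  shows "integrable M (\<lambda>\<omega>. X \<omega> * Y \<omega>)"
proof (cases q)
  case (real s)
  with pq q p have s: "1 < s" and ps: "1 / p + 1 / s = 1"
    by (auto simp: one_ereal_def)
  \<comment> \<open>A finite conjugate exponent has 1/s > 0, which excludes p = 1; Young's
    inequality needs both exponents above 1.\<close>
  have "p \<noteq> 1"
    using ps s by auto
  with p have p1: "1 < p" by simp
  have Xi: "integrable M (\<lambda>\<omega>. \<bar>X \<omega>\<bar> powr p)" and Yi: "integrable M (\<lambda>\<omega>. \<bar>Y \<omega>\<bar> powr s)"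
    and [measurable]: "X \<in> borel_measurable M" "Y \<in> borel_measurable M"
    using X Y real by (auto simp: Lp_space_ereal_iff)
  show ?thesis
  proof (rule Bochner_Integration.integrable_bound)
    show "integrable M (\<lambda>\<omega>. \<bar>X \<omega>\<bar> powr p / p + \<bar>Y \<omega>\<bar> powr s / s)"
      using Xi Yi by auto
    show "AE \<omega> in M. norm (X \<omega> * Y \<omega>) \<le> norm (\<bar>X \<omega>\<bar> powr p / p + \<bar>Y \<omega>\<bar> powr s / s)"
    proof (rule AE_I2)
      fix \<omega>
      show "norm (X \<omega> * Y \<omega>) \<le> norm (\<bar>X \<omega>\<bar> powr p / p + \<bar>Y \<omega>\<bar> powr s / s)"
        using Youngs_inequality[OF p1 s ps, of "\<bar>X \<omega>\<bar>" "\<bar>Y \<omega>\<bar>"]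
        by (simp add: abs_mult)
    qed
  qed measurable
next
  case PInf
  with pq p have p1: "p = 1"
    by (auto simp: one_ereal_def)
  obtain C where C: "AE \<omega> in M. \<bar>Y \<omega>\<bar> \<le> C" and [measurable]: "Y \<in> borel_measurable M"
    using Y PInf by (auto simp: Lp_space_def)
  have [measurable]: "X \<in> borel_measurable M" and Xi: "integrable M (\<lambda>\<omega>. \<bar>X \<omega>\<bar>)"
    using X p1 by (auto simp: Lp_space_ereal_iff)
  show ?thesis
  proof (rule Bochner_Integration.integrable_bound)
    show "integrable M (\<lambda>\<omega>. \<bar>X \<omega>\<bar> * C)"
      using Xi by auto
    show "AE \<omega> in M. norm (X \<omega> * Y \<omega>) \<le> norm (\<bar>X \<omega>\<bar> * C)"
      using C by eventually_elim (auto simp: abs_mult intro!: mult_left_mono)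
  qed measurable
qed (use q in auto)

text \<open>A subset of a separable pseudometric space is separable. The dense sets in
  \<open>P1\<close> need not be preimages under \<open>\<zeta>\<close>, so each of them is replaced,
  for every accuracy 1/(n+1), by one set of \<open>N\<close> whose preimage is that close to it, if
  there is one.\<close>

lemma separable_measure_distr:
  assumes "prob_space P1" and sep: "separable_measure P1" and \<zeta>[measurable]: "\<zeta> \<in> P1 \<rightarrow>\<^sub>M N"
  shows "separable_measure (distr P1 N \<zeta>)"
proof -
  interpret P1: prob_space P1 by fact
  obtain \<C> where \<C>: "countable \<C>" "\<C> \<subseteq> sets P1"
      "\<And>A \<epsilon>. A \<in> sets P1 \<Longrightarrow> \<epsilon> > 0 \<Longrightarrow> \<exists>C\<in>\<C>. measure P1 (sym_diff A C) < \<epsilon>"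
    using sep by (auto simp: separable_measure_def)
  define near where "near C n B \<longleftrightarrow> B \<in> sets N \<and>
      measure P1 (sym_diff (\<zeta> -` B \<inter> space P1) C) < 1 / Suc n" for C B and n :: nat
  \<comment> \<open>The default \<open>{}\<close> keeps \<open>pick C n\<close> in
    \<open>sets N\<close> when no preimage is near \<open>C\<close>.\<close>
  define pick where "pick C n = (if \<exists>B. near C n B then SOME B. near C n B else {})" for C n
  have pick: "near C n (pick C n)" if "near C n B" for C n B
    using someI[of "near C n", OF that] that unfolding pick_def by auto
  have pick_sets: "pick C n \<in> sets N" for C n
  proof (cases "\<exists>B. near C n B")
    case True
    then show ?thesis
      using pick[of C n] by (auto simp: near_def)
  qed (simp add: pick_def)
  define \<D> where "\<D> = (\<lambda>(C, n). pick C n) ` (\<C> \<times> UNIV)"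
  have "\<exists>B\<in>\<D>. measure (distr P1 N \<zeta>) (sym_diff A B) < \<epsilon>"
    if A: "A \<in> sets N" and "\<epsilon> > 0" for A and \<epsilon> :: real
  proof -
    obtain n where n: "1 / Suc n < \<epsilon> / 2"
      using \<open>\<epsilon> > 0\<close> nat_approx_posE[of "\<epsilon> / 2"] by auto
    have [measurable]: "\<zeta> -` A \<inter> space P1 \<in> sets P1"
      using A by measurable
    obtain C where C: "C \<in> \<C>" "measure P1 (sym_diff (\<zeta> -` A \<inter> space P1) C) < 1 / Suc n"
      using \<C>(3)[of "\<zeta> -` A \<inter> space P1" "1 / Suc n"] by auto
    have [measurable]: "C \<in> sets P1"
      using C \<C> by auto
    let ?B = "pick C n"
    \<comment> \<open>\<open>A\<close> itself witnesses that some set is near \<open>C\<close>, so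
      the chosen one is near as well. Both preimages are then within 1/(n+1) < \<epsilon>/2 of
      \<open>C\<close>.\<close>
    have nB: "near C n ?B"
      using C A by (intro pick[of C n A]) (auto simp: near_def)
    note pick_sets[measurable] A[measurable]
    have "measure (distr P1 N \<zeta>) (sym_diff A ?B) =
        measure P1 (sym_diff (\<zeta> -` A \<inter> space P1) (\<zeta> -` ?B \<inter> space P1))"
      by (subst measure_distr) (auto intro!: arg_cong[where f="measure P1"])
    also have "\<dots> \<le> measure P1 (sym_diff (\<zeta> -` A \<inter> space P1) C \<union>
        sym_diff (\<zeta> -` ?B \<inter> space P1) C)"
      by (intro P1.finite_measure_mono) auto
    also have "\<dots> \<le> measure P1 (sym_diff (\<zeta> -` A \<inter> space P1) C) +
        measure P1 (sym_diff (\<zeta> -` ?B \<inter> space P1) C)"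
      by (intro measure_Un_le) auto
    also have "\<dots> < \<epsilon>"
      using C(2) nB n by (auto simp: near_def)
    finally show ?thesis
      using C by (auto simp: \<D>_def)
  qed
  then show ?thesis
    unfolding separable_measure_def using \<C>(1) pick_sets
    by (intro exI[of _ \<D>]) (auto simp: \<D>_def)
qed

section \<open>Integrals under the measures of the dual set and the weak topology\<close>

locale dual_risk_measure = prob_space M for M :: "'o measure" +
  fixes p :: real and q :: ereal and \<rho> :: "('o \<Rightarrow> real) \<Rightarrow> ereal" and \<Q> :: "'o measure set"
  assumes exponents: "1 \<le> p" "1 < q" "1 / ereal p + 1 / q = 1"
    and dual: "dual_representation M (ereal p) q \<rho> \<Q>"
begin

lemma p_nonneg: "0 \<le> p"
  using exponents by simp

lemma dual_setD:
  assumes "Q \<in> \<Q>"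
  shows "prob_space Q" "sets Q = sets M" "absolutely_continuous M Q"
    "dual_density M Q \<in> Lp_space M q"
  using assms dual by (auto simp: dual_representation_def prob_measures_dual_def)

lemma dual_set_space: "Q \<in> \<Q> \<Longrightarrow> space Q = space M"
  by (intro sets_eq_imp_space_eq dual_setD)

lemma dual_set_AE: "Q \<in> \<Q> \<Longrightarrow> AE \<omega> in M. P \<omega> \<Longrightarrow> AE \<omega> in Q. P \<omega>"
  by (rule absolutely_continuous_AE) (auto simp: dual_setD)

text \<open>The density of \<open>Q\<close> lies in L^q, so Hoelder's inequality applies to the
  product. The second identity rewrites the expectation as the duality pairing by which the weak
  topology is defined.\<close>

lemma
  assumes "Q \<in> \<Q>" and X: "X \<in> Lp_space M (ereal p)"
  shows dual_set_integrable: "integrable Q X"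
    and dual_set_integral: "(\<integral>\<omega>. X \<omega> \<partial>Q) = (\<integral>\<omega>. X \<omega> * dual_density M Q \<omega> \<partial>M)"
proof -
  note Q = dual_setD[OF \<open>Q \<in> \<Q>\<close>]
  interpret Q: prob_space Q by (rule Q)
  have "integrable M (\<lambda>\<omega>. X \<omega> * dual_density M Q \<omega>)"
    using Lp_space_mult_integrable[OF exponents X Q(4)] .
  then show "integrable Q X"
    using RN_deriv_integrable[of Q X] Q X
    by (simp add: Lp_space_measurable dual_density_def mult.commute Q.sigma_finite_measure_axioms)
  show "(\<integral>\<omega>. X \<omega> \<partial>Q) = (\<integral>\<omega>. X \<omega> * dual_density M Q \<omega> \<partial>M)"
    using RN_deriv_integral[of Q X] Q X
    by (simp add: Lp_space_measurable dual_density_def mult.commute Q.sigma_finite_measure_axioms)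
qed

lemma integral_le_rho:
  "Q \<in> \<Q> \<Longrightarrow> X \<in> Lp_space M (ereal p) \<Longrightarrow> ereal (\<integral>\<omega>. X \<omega> \<partial>Q) \<le> \<rho> X"
  using dual by (auto simp: dual_representation_def)

lemma rho_attained:
  "X \<in> Lp_space M (ereal p) \<Longrightarrow> \<exists>Q\<in>\<Q>. \<rho> X = ereal (\<integral>\<omega>. X \<omega> \<partial>Q)"
  using dual by (auto simp: dual_representation_def)

lemma openin_integral:
  assumes X: "X \<in> Lp_space M (ereal p)" and U: "open U"
  shows "openin (weak_topology_measures M q (ereal p))
     {Q \<in> prob_measures_dual M q. (\<integral>\<omega>. X \<omega> * dual_density M Q \<omega> \<partial>M) \<in> U}"
proof -
  have "openin (weak_topology_Lp M q (ereal p)) {Y \<in> Lp_space M q. (\<integral>\<omega>. X \<omega> * Y \<omega> \<partial>M) \<in> U}"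
    unfolding weak_topology_Lp_def using X U by (intro topology_generated_by_Basis) auto
  then show ?thesis
    unfolding weak_topology_measures_def openin_pullback_topology
    by (intro exI conjI, assumption) (auto simp: prob_measures_dual_def)
qed

text \<open>Evaluation at a fixed \<open>X\<close> is weakly continuous on \<open>\<Q>\<close>. This
  is the link between the Borel sets of \<open>\<Q>\<close> and the measurability of
  kernels.\<close>

lemma measurable_integral_dual_borel:
  assumes X: "X \<in> Lp_space M (ereal p)"
  shows "(\<lambda>Q. \<integral>\<omega>. X \<omega> \<partial>Q) \<in> borel_measurable (dual_borel M (ereal p) q \<Q>)"
proof (rule borel_measurableI)
  fix U :: "real set" assume U: "open U"
  have sub: "{U. openin (subtopology (weak_topology_measures M q (ereal p)) \<Q>) U} \<subseteq> Pow \<Q>"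
    by (auto simp: openin_subtopology)
  have "(\<lambda>Q. \<integral>\<omega>. X \<omega> \<partial>Q) -` U \<inter> \<Q> =
     {Q \<in> prob_measures_dual M q. (\<integral>\<omega>. X \<omega> * dual_density M Q \<omega> \<partial>M) \<in> U} \<inter> \<Q>"
    using X dual by (auto simp: dual_set_integral dual_representation_def)
  then have "openin (subtopology (weak_topology_measures M q (ereal p)) \<Q>)
      ((\<lambda>Q. \<integral>\<omega>. X \<omega> \<partial>Q) -` U \<inter> \<Q>)"
    using openin_integral[OF X U] by (auto simp: openin_subtopology)
  then show "(\<lambda>Q. \<integral>\<omega>. X \<omega> \<partial>Q) -` U \<inter> space (dual_borel M (ereal p) q \<Q>) \<in>
      sets (dual_borel M (ereal p) q \<Q>)"
    using sub unfolding dual_borel_def by (auto intro!: sigma_sets.Basic)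
qed

text \<open>A Dini argument: for each \<open>Q\<close> the integrals decrease to 0, and they are continuous in \<open>Q\<close>.\<close>

lemma uniform_convergence_dual_set:
  assumes V: "\<And>n. V n \<in> Lp_space M (ereal p)"
    and nonneg: "\<And>n \<omega>. \<omega> \<in> space M \<Longrightarrow> 0 \<le> V n \<omega>"
    and decr: "\<And>n \<omega>. \<omega> \<in> space M \<Longrightarrow> V (Suc n) \<omega> \<le> V n \<omega>"
    and lim: "AE \<omega> in M. (\<lambda>n. V n \<omega>) \<longlonglongrightarrow> 0"
    and "0 < \<epsilon>"
  shows "\<exists>n. \<forall>Q\<in>\<Q>. (\<integral>\<omega>. V n \<omega> \<partial>Q) < \<epsilon>"
proof -
  have dec: "V n \<omega> \<le> V m \<omega>" if "\<omega> \<in> space M" "m \<le> n" for m n \<omega>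
    by (rule lift_Suc_antimono_le[of "\<lambda>n. V n \<omega>", OF decr[OF that(1)] that(2)])
  let ?T = "weak_topology_measures M q (ereal p)"
  \<comment> \<open>Weakly open sets which, within \<open>\<Q>\<close>, increase with
    \<open>n\<close> because \<open>V\<close> decreases. A finite subcover is therefore controlled
    by its largest index; inserting 0 below keeps \<open>Max\<close> meaningful if the subcover is
    empty.\<close>
  define O' where "O' n = {Q \<in> prob_measures_dual M q.
      (\<integral>\<omega>. V n \<omega> * dual_density M Q \<omega> \<partial>M) \<in> {..<\<epsilon>}}" for n
  have O'_open: "openin ?T (O' n)" for n
    unfolding O'_def by (intro openin_integral V) auto
  have O'_iff: "Q \<in> O' n \<longleftrightarrow> (\<integral>\<omega>. V n \<omega> \<partial>Q) < \<epsilon>" if "Q \<in> \<Q>" for Q n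
    using that V dual by (auto simp: O'_def dual_set_integral dual_representation_def)
  have "\<exists>n. Q \<in> O' n" if Q: "Q \<in> \<Q>" for Q
  proof -
    have "(\<lambda>n. \<integral>\<omega>. V n \<omega> \<partial>Q) \<longlonglongrightarrow> (\<integral>\<omega>. 0 \<partial>Q)"
    proof (rule integral_dominated_convergence)
      show "integrable Q (V 0)"
        using Q V by (rule dual_set_integrable)
      show "AE \<omega> in Q. (\<lambda>n. V n \<omega>) \<longlonglongrightarrow> 0"
        using Q lim by (rule dual_set_AE)
      show "AE \<omega> in Q. norm (V n \<omega>) \<le> V 0 \<omega>" for n
        using nonneg dec[of _ 0 n] by (auto simp: dual_set_space[OF Q] intro!: AE_I2)
    qed (use V dual_set_integrable[OF Q] in auto)
    then have "\<forall>\<^sub>F n in sequentially. (\<integral>\<omega>. V n \<omega> \<partial>Q) < \<epsilon>"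
      using \<open>0 < \<epsilon>\<close> by (auto intro: order_tendstoD)
    then show ?thesis
      using O'_iff[OF Q] by (auto simp: eventually_sequentially)
  qed
  then have "\<Q> \<subseteq> \<Union>(range O')"
    by auto
  moreover have "compactin ?T \<Q>"
    using dual by (simp add: dual_representation_def)
  ultimately obtain \<F> where \<F>: "finite \<F>" "\<F> \<subseteq> range O'" "\<Q> \<subseteq> \<Union>\<F>"
    using O'_open unfolding compactin_def by (metis (no_types, lifting) rangeE)
  obtain I where I: "finite I" "\<F> = O' ` I"
    using \<F>(1,2) finite_subset_image by metis
  have "(\<integral>\<omega>. V (Max (insert 0 I)) \<omega> \<partial>Q) < \<epsilon>" if Q: "Q \<in> \<Q>" for Q
  proof -
    obtain i where i: "i \<in> I" "Q \<in> O' i"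
      using Q \<F>(3) I by auto
    have "(\<integral>\<omega>. V (Max (insert 0 I)) \<omega> \<partial>Q) \<le> (\<integral>\<omega>. V i \<omega> \<partial>Q)"
      using i I by (intro integral_mono dual_set_integrable[OF Q] V dec)
        (auto simp: dual_set_space[OF Q])
    then show ?thesis
      using i O'_iff[OF Q] by auto
  qed
  then show ?thesis by blast
qed

end

section \<open>Approximation uniform over the dual set and countable norming families\<close>

text \<open>Lists over a countable type are countable, so these step functions can be enumerated.
  Overlapping sets and repeated entries are harmless, and appending lists adds the
  functions.\<close>

definition rational_step :: "(nat \<Rightarrow> 'z set) \<Rightarrow> (rat \<times> nat) list \<Rightarrow> 'z \<Rightarrow> real" where
  "rational_step B l z = (\<Sum>(r, j)\<leftarrow>l. of_rat r * indicator (B j) z)"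

lemma rational_step_simps [simp]:
  "rational_step B [] z = 0"
  "rational_step B ((r, j) # l) z = of_rat r * indicator (B j) z + rational_step B l z"
  "rational_step B (l @ l') z = rational_step B l z + rational_step B l' z"
  by (simp_all add: rational_step_def)

context dual_risk_measure
begin

text \<open>Otherwise there are sets of probability below 2^(-n) to which some members of
  \<open>\<Q>\<close> give mass at least \<epsilon>. Borel-Cantelli makes the indicators of their
  tail unions decrease to 0 almost surely, and the Dini argument then contradicts the lower
  bound.\<close>

lemma uniformly_absolutely_continuous:
  assumes "0 < \<epsilon>"
  shows "\<exists>\<delta>>0. \<forall>A\<in>sets M. measure M A < \<delta> \<longrightarrow> (\<forall>Q\<in>\<Q>. measure Q A < \<epsilon>)"
proof (rule ccontr)
  assume neg: "\<not> ?thesis"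
  have "\<exists>A Q. A \<in> sets M \<and> measure M A < (1 / 2) ^ n \<and> Q \<in> \<Q> \<and> \<epsilon> \<le> measure Q A" for n :: nat
  proof -
    have "(0::real) < (1 / 2) ^ n"
      by simp
    with neg show ?thesis
      by (meson not_le)
  qed
  then obtain A R where AR: "\<And>n. A n \<in> sets M" "\<And>n. measure M (A n) < (1 / 2) ^ n"
      "\<And>n. R n \<in> \<Q>" "\<And>n. \<epsilon> \<le> measure (R n) (A n)"
    by metis
  define V where "V n = (indicator (\<Union>m\<in>{n..}. A m) :: 'o \<Rightarrow> real)" for n
  have [measurable]: "(\<Union>m\<in>{n..}. A m) \<in> sets M" for n
    using AR(1) by auto
  have V_Lp: "V n \<in> Lp_space M (ereal p)" for n
    by (rule Lp_space_bounded[where C=1]) (auto simp: V_def p_nonneg finite_measure_axioms indicator_def)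
  have "summable (\<lambda>n. measure M (A n))"
    by (rule summable_comparison_test'[where g="\<lambda>n. (1 / 2) ^ n" and N=0])
      (use AR(2) in \<open>auto intro: less_imp_le\<close>)
  then have "AE \<omega> in M. \<forall>\<^sub>F n in sequentially. \<omega> \<in> space M - A n"
    by (intro borel_cantelli_AE1) (use AR(1) in \<open>auto simp: less_top[symmetric]\<close>)
  then have lim: "AE \<omega> in M. (\<lambda>n. V n \<omega>) \<longlonglongrightarrow> 0"
  proof eventually_elim
    case (elim \<omega>)
    then obtain k where "\<And>n. k \<le> n \<Longrightarrow> \<omega> \<notin> A n"
      by (auto simp: eventually_sequentially)
    then have "\<forall>\<^sub>F n in sequentially. V n \<omega> = 0"
      unfolding eventually_sequentially V_def by (intro exI[of _ k]) auto
    then show ?case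
      by (rule tendsto_eventually)
  qed
  have "V (Suc n) \<omega> \<le> V n \<omega>" for n \<omega>
  proof -
    have "(\<Union>m\<in>{Suc n..}. A m) \<subseteq> (\<Union>m\<in>{n..}. A m)"
      by force
    then show ?thesis
      unfolding V_def by (auto simp: indicator_def)
  qed
  with uniform_convergence_dual_set[of V, OF V_Lp _ _ lim \<open>0 < \<epsilon>\<close>]
  obtain n where n: "\<And>Q. Q \<in> \<Q> \<Longrightarrow> (\<integral>\<omega>. V n \<omega> \<partial>Q) < \<epsilon>"
    by (auto simp: V_def)
  note R = dual_setD[OF AR(3)[of n]]
  interpret R: prob_space "R n" by (rule R)
  have "measure (R n) (A n) \<le> measure (R n) (\<Union>m\<in>{n..}. A m)"
    using AR(1) by (intro R.finite_measure_mono) (auto simp: R)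
  also have "\<dots> = (\<integral>\<omega>. V n \<omega> \<partial>R n)"
    using R by (simp add: V_def)
  also have "\<dots> < \<epsilon>"
    using n AR(3) by blast
  finally show False
    using AR(4)[of n] by simp
qed

text \<open>The tail suprema of |W m| are still dominated by \<open>Y\<close> but decrease to 0,
  which reduces the claim to the monotone case.\<close>

lemma uniform_dominated_convergence_dual_set:
  assumes [measurable]: "\<And>n. W n \<in> borel_measurable M" and Y: "Y \<in> Lp_space M (ereal p)"
    and le: "\<And>n \<omega>. \<omega> \<in> space M \<Longrightarrow> \<bar>W n \<omega>\<bar> \<le> Y \<omega>"
    and lim: "\<And>\<omega>. \<omega> \<in> space M \<Longrightarrow> (\<lambda>n. W n \<omega>) \<longlonglongrightarrow> 0"
    and "0 < \<epsilon>"
  shows "\<exists>n. \<forall>Q\<in>\<Q>. (\<integral>\<omega>. \<bar>W n \<omega>\<bar> \<partial>Q) < \<epsilon>"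
proof -
  define V where "V n \<omega> = (SUP m\<in>{n..}. \<bar>W m \<omega>\<bar>)" for n \<omega>
  have bdd: "bdd_above ((\<lambda>m. \<bar>W m \<omega>\<bar>) ` I)" if "\<omega> \<in> space M" for \<omega> I
    using le[OF that] by (intro bdd_aboveI2) auto
  have W_le_V: "\<bar>W m \<omega>\<bar> \<le> V n \<omega>" if "\<omega> \<in> space M" "n \<le> m" for \<omega> n m
    unfolding V_def using that bdd by (intro cSUP_upper) auto
  have V_nonneg: "0 \<le> V n \<omega>" if "\<omega> \<in> space M" for \<omega> n
    using W_le_V[OF that order_refl, of n] by linarith
  have V_le_Y: "V n \<omega> \<le> Y \<omega>" if "\<omega> \<in> space M" for \<omega> n
    unfolding V_def using le[OF that] by (intro cSUP_least) auto
  have [measurable]: "V n \<in> borel_measurable M" for n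
    unfolding V_def using bdd by (intro borel_measurable_cSUP) auto
  have V_Lp: "V n \<in> Lp_space M (ereal p)" for n
    using V_nonneg V_le_Y by (intro Lp_space_dominated[OF Y p_nonneg])
        (auto intro: order_trans[OF _ abs_ge_self])
  have decr: "V (Suc n) \<omega> \<le> V n \<omega>" if "\<omega> \<in> space M" for n \<omega>
    unfolding V_def using bdd that by (intro cSUP_subset_mono) auto
  have "(\<lambda>n. V n \<omega>) \<longlonglongrightarrow> 0" if \<omega>: "\<omega> \<in> space M" for \<omega>
  proof (rule LIMSEQ_I)
    fix r :: real assume "0 < r"
    then obtain k where k: "\<And>m. k \<le> m \<Longrightarrow> \<bar>W m \<omega>\<bar> \<le> r / 2"
      using LIMSEQ_D[OF lim[OF \<omega>], of "r / 2"] by (auto intro: less_imp_le)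
    have "V n \<omega> \<le> r / 2" if "k \<le> n" for n
      unfolding V_def using k that by (intro cSUP_least) auto
    then show "\<exists>k. \<forall>n\<ge>k. norm (V n \<omega> - 0) < r"
      using V_nonneg[OF \<omega>] \<open>0 < r\<close> by (intro exI[of _ k]) (auto intro: le_less_trans[of _ "r / 2"])
  qed
  then obtain n where n: "\<And>Q. Q \<in> \<Q> \<Longrightarrow> (\<integral>\<omega>. V n \<omega> \<partial>Q) < \<epsilon>"
    using uniform_convergence_dual_set[of V, OF V_Lp V_nonneg decr _ \<open>0 < \<epsilon>\<close>] by auto
  have "(\<integral>\<omega>. \<bar>W n \<omega>\<bar> \<partial>Q) < \<epsilon>" if Q: "Q \<in> \<Q>" for Q
  proof -
    have "(\<lambda>\<omega>. \<bar>W n \<omega>\<bar>) \<in> Lp_space M (ereal p)"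
      using le by (intro Lp_space_dominated[OF Y p_nonneg])
        (auto intro: order_trans[OF _ abs_ge_self])
    then have "(\<integral>\<omega>. \<bar>W n \<omega>\<bar> \<partial>Q) \<le> (\<integral>\<omega>. V n \<omega> \<partial>Q)"
      using W_le_V by (intro integral_mono dual_set_integrable[OF Q] V_Lp)
        (auto simp: dual_set_space[OF Q])
    with n[OF Q] show ?thesis by simp
  qed
  then show ?thesis by blast
qed

lemma rational_step_Lp:
  assumes [measurable]: "Z \<in> M \<rightarrow>\<^sub>M MZ" "\<And>j. B j \<in> sets MZ"
  shows "(\<lambda>\<omega>. rational_step B l (Z \<omega>)) \<in> Lp_space M (ereal p)"
proof (induction l)
  case Nil
  show ?case
    by (rule Lp_space_bounded[where C=0]) (auto simp: p_nonneg finite_measure_axioms)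
next
  case (Cons a l)
  obtain r j where a: "a = (r, j)" by force
  have "(\<lambda>\<omega>. of_rat r * indicator (B j) (Z \<omega>) :: real) \<in> Lp_space M (ereal p)"
    by (rule Lp_space_bounded[where C="\<bar>of_rat r\<bar>"])
      (auto simp: p_nonneg finite_measure_axioms indicator_def)
  from Lp_space_add[OF this Cons p_nonneg] show ?case
    by (simp add: a)
qed

text \<open>The usual ascent from indicators through simple functions to limits, with the error
  measured by the supremum of the L^1(Q) distances over \<open>\<Q>\<close>. Equi-absolute
  continuity handles the indicators, uniform dominated convergence the limits.\<close>

lemma uniform_rational_step_approximation:
  assumes Z[measurable]: "Z \<in> M \<rightarrow>\<^sub>M MZ" and B[measurable]: "\<And>j. B j \<in> sets MZ"
    and dense: "\<And>A \<epsilon>. A \<in> sets MZ \<Longrightarrow> 0 < \<epsilon> \<Longrightarrow> \<exists>j. measure (distr M MZ Z) (sym_diff A (B j)) < \<epsilon>"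
    and f[measurable]: "f \<in> borel_measurable MZ" and fLp: "(\<lambda>\<omega>. f (Z \<omega>)) \<in> Lp_space M (ereal p)"
    and "0 < \<epsilon>"
  shows "\<exists>l. \<forall>Q\<in>\<Q>. (\<integral>\<omega>. \<bar>f (Z \<omega>) - rational_step B l (Z \<omega>)\<bar> \<partial>Q) < \<epsilon>"
proof -
  define L where "L = {f \<in> borel_measurable MZ. (\<lambda>\<omega>. f (Z \<omega>) :: real) \<in> Lp_space M (ereal p)}"
  define approx where "approx f \<longleftrightarrow> (\<forall>\<epsilon>>0. \<exists>l. \<forall>Q\<in>\<Q>.
      (\<integral>\<omega>. \<bar>f (Z \<omega>) - rational_step B l (Z \<omega>)\<bar> \<partial>Q) < \<epsilon>)" for f
  have step_L: "rational_step B l \<in> L" for l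
  proof -
    have "rational_step B l \<in> borel_measurable MZ"
    proof (induction l)
      case (Cons a l)
      obtain r j where "a = (r, j)" by force
      with Cons show ?case by simp
    qed (simp add: rational_step_def)
    then show ?thesis
      using rational_step_Lp[OF Z B] by (simp add: L_def)
  qed
  have L_add: "(\<lambda>z. f z + g z) \<in> L" and L_diff: "(\<lambda>z. f z - g z) \<in> L" if "f \<in> L" "g \<in> L" for f g
    using that p_nonneg by (auto simp: L_def Lp_space_add Lp_space_diff)
  have L_abs: "(\<lambda>z. \<bar>f z\<bar>) \<in> L" if "f \<in> L" for f
    using that by (auto simp: L_def Lp_space_abs)
  have int: "integrable Q (\<lambda>\<omega>. f (Z \<omega>))" if "f \<in> L" "Q \<in> \<Q>" for f Q
    using that dual_set_integrable by (auto simp: L_def)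
  have triangle: "\<forall>Q\<in>\<Q>. (\<integral>\<omega>. \<bar>f (Z \<omega>) - h (Z \<omega>)\<bar> \<partial>Q) < r + s"
    if "f \<in> L" "g \<in> L" "h \<in> L" "\<forall>Q\<in>\<Q>. (\<integral>\<omega>. \<bar>f (Z \<omega>) - g (Z \<omega>)\<bar> \<partial>Q) < r"
      "\<forall>Q\<in>\<Q>. (\<integral>\<omega>. \<bar>g (Z \<omega>) - h (Z \<omega>)\<bar> \<partial>Q) < s" for f g h r s
  proof
    fix Q assume Q: "Q \<in> \<Q>"
    have "(\<integral>\<omega>. \<bar>f (Z \<omega>) - h (Z \<omega>)\<bar> \<partial>Q) \<le>
        (\<integral>\<omega>. \<bar>f (Z \<omega>) - g (Z \<omega>)\<bar> + \<bar>g (Z \<omega>) - h (Z \<omega>)\<bar> \<partial>Q)"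
      by (intro integral_mono int[OF L_abs[OF L_diff] Q]
          int[OF L_add[OF L_abs[OF L_diff] L_abs[OF L_diff]] Q]) (use that in auto)
    also have "\<dots> = (\<integral>\<omega>. \<bar>f (Z \<omega>) - g (Z \<omega>)\<bar> \<partial>Q) + (\<integral>\<omega>. \<bar>g (Z \<omega>) - h (Z \<omega>)\<bar> \<partial>Q)"
      by (intro Bochner_Integration.integral_add int[OF L_abs[OF L_diff] Q] that)
    finally show "(\<integral>\<omega>. \<bar>f (Z \<omega>) - h (Z \<omega>)\<bar> \<partial>Q) < r + s"
      using that(4,5) Q by force
  qed
  have approx_lim: "approx f" if fL: "f \<in> L" and lim: "\<And>e. 0 < e \<Longrightarrow> \<exists>g\<in>L. approx g \<and> (\<forall>Q\<in>\<Q>. (\<integral>\<omega>. \<bar>f (Z \<omega>) - g (Z \<omega>)\<bar> \<partial>Q) < e)" for f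
    unfolding approx_def
  proof (intro allI impI)
    fix e :: real assume "0 < e"
    then obtain g where g: "g \<in> L" "approx g" "\<forall>Q\<in>\<Q>. (\<integral>\<omega>. \<bar>f (Z \<omega>) - g (Z \<omega>)\<bar> \<partial>Q) < e / 2"
      using lim[of "e / 2"] by auto
    obtain l where "\<forall>Q\<in>\<Q>. (\<integral>\<omega>. \<bar>g (Z \<omega>) - rational_step B l (Z \<omega>)\<bar> \<partial>Q) < e / 2"
      using g(2) \<open>0 < e\<close> unfolding approx_def by (meson half_gt_zero)
    from triangle[OF fL g(1) step_L g(3) this]
    show "\<exists>l. \<forall>Q\<in>\<Q>. (\<integral>\<omega>. \<bar>f (Z \<omega>) - rational_step B l (Z \<omega>)\<bar> \<partial>Q) < e"
      by auto
  qed
  have approx_add: "approx (\<lambda>z. f z + g z)" if fL: "f \<in> L" and gL: "g \<in> L" and ap: "approx f" "approx g" for f g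
    unfolding approx_def
  proof (intro allI impI)
    fix e :: real assume "0 < e"
    then have "0 < e / 2" by simp
    then obtain l l' where l: "\<forall>Q\<in>\<Q>. (\<integral>\<omega>. \<bar>f (Z \<omega>) - rational_step B l (Z \<omega>)\<bar> \<partial>Q) < e / 2"
        "\<forall>Q\<in>\<Q>. (\<integral>\<omega>. \<bar>g (Z \<omega>) - rational_step B l' (Z \<omega>)\<bar> \<partial>Q) < e / 2"
      using ap unfolding approx_def by meson
    show "\<exists>l. \<forall>Q\<in>\<Q>. (\<integral>\<omega>. \<bar>f (Z \<omega>) + g (Z \<omega>) - rational_step B l (Z \<omega>)\<bar> \<partial>Q) < e"
    proof (intro exI[of _ "l @ l'"])
      \<comment> \<open>The intermediate function replaces \<open>f\<close> by its step function but
        keeps \<open>g\<close>, so each half of the error involves one approximation.\<close>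
      have "\<forall>Q\<in>\<Q>. (\<integral>\<omega>. \<bar>(f (Z \<omega>) + g (Z \<omega>)) -
          (rational_step B l (Z \<omega>) + rational_step B l' (Z \<omega>))\<bar> \<partial>Q) < e / 2 + e / 2"
        by (rule triangle[OF L_add[OF fL gL] L_add[OF step_L gL] L_add[OF step_L step_L]])
          (use l in \<open>auto simp: algebra_simps\<close>)
      then show "\<forall>Q\<in>\<Q>. (\<integral>\<omega>. \<bar>f (Z \<omega>) + g (Z \<omega>) - rational_step B (l @ l') (Z \<omega>)\<bar> \<partial>Q) < e"
        by simp
    qed
  qed
  have indicator_L: "(\<lambda>z. k * indicator A z) \<in> L" if [measurable]: "A \<in> sets MZ" for A k
  proof -
    have "(\<lambda>\<omega>. k * indicator A (Z \<omega>)) \<in> Lp_space M (ereal p)"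
      by (rule Lp_space_bounded[where C="\<bar>k\<bar>"])
        (auto simp: p_nonneg finite_measure_axioms indicator_def)
    then show ?thesis by (simp add: L_def)
  qed
  have approx_indicator: "approx (\<lambda>z. k * indicator A z)" if A[measurable]: "A \<in> sets MZ" for A k
    unfolding approx_def
  proof (intro allI impI)
    fix e :: real assume "0 < e"
    obtain r where r: "\<bar>k - of_rat r\<bar> < e / 2"
    proof -
      obtain r where "k - e / 2 < of_rat r" "of_rat r < k"
        using of_rat_dense[of "k - e / 2" k] \<open>0 < e\<close> by auto
      then have "\<bar>k - of_rat r\<bar> < e / 2"
        by linarith
      then show ?thesis by (rule that)
    qed
    \<comment> \<open>The summand 1 keeps the divisor positive when \<open>r\<close> is 0.\<close>
    define K where "K = \<bar>of_rat r\<bar> + (1::real)"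
    have K: "0 < K" "\<bar>of_rat r\<bar> \<le> K"
      unfolding K_def by linarith+
    have *: "0 < e / (2 * K)"
      using \<open>0 < e\<close> K by simp
    obtain \<delta> where \<delta>: "0 < \<delta>"
      "\<And>C Q. C \<in> sets M \<Longrightarrow> measure M C < \<delta> \<Longrightarrow> Q \<in> \<Q> \<Longrightarrow> measure Q C < e / (2 * K)"
      using uniformly_absolutely_continuous[OF *] by blast
    obtain j where j: "measure (distr M MZ Z) (sym_diff A (B j)) < \<delta>"
      using dense[OF A \<delta>(1)] by blast
    let ?C = "Z -` sym_diff A (B j) \<inter> space M"
    have C[measurable]: "?C \<in> sets M"
      by measurable
    have "measure M ?C < \<delta>"
      using j by (simp add: measure_distr)
    have "(\<integral>\<omega>. \<bar>k * indicator A (Z \<omega>) - rational_step B [(r, j)] (Z \<omega>)\<bar> \<partial>Q) < e" if Q: "Q \<in> \<Q>" for Q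
    proof -
      interpret Q: prob_space Q by (rule dual_setD[OF Q])
      have [measurable_cong]: "sets Q = sets M"
        using Q by (rule dual_setD)
      have sp: "space Q = space M"
        using Q by (rule dual_set_space)
      \<comment> \<open>The constant pays for replacing \<open>k\<close> by the rational
        \<open>r\<close>; the indicator pays for the outcomes at which \<open>A\<close> and
        \<open>B j\<close> disagree.\<close>
      have "(\<integral>\<omega>. \<bar>k * indicator A (Z \<omega>) - rational_step B [(r, j)] (Z \<omega>)\<bar> \<partial>Q) \<le>
          (\<integral>\<omega>. \<bar>k - of_rat r\<bar> + \<bar>of_rat r\<bar> * indicator ?C \<omega> \<partial>Q)"
      proof (intro integral_mono int[OF L_abs[OF L_diff[OF indicator_L step_L]] Q])
        show "integrable Q (\<lambda>\<omega>. \<bar>k - of_rat r\<bar> + \<bar>of_rat r\<bar> * indicator ?C \<omega>)"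
          by (intro Bochner_Integration.integrable_add integrable_mult_right integrable_real_indicator)
            (use C dual_setD(2)[OF Q] in \<open>simp_all add: less_top[symmetric]\<close>)
        fix \<omega> assume "\<omega> \<in> space Q"
        then show "\<bar>k * indicator A (Z \<omega>) - rational_step B [(r, j)] (Z \<omega>)\<bar> \<le>
            \<bar>k - of_rat r\<bar> + \<bar>of_rat r\<bar> * indicator ?C \<omega>"
          by (cases "Z \<omega> \<in> A"; cases "Z \<omega> \<in> B j"; simp add: sp del: abs_of_rat; linarith?)
      qed (rule A)
      also have "\<dots> = \<bar>k - of_rat r\<bar> + \<bar>of_rat r\<bar> * measure Q ?C"
        by (subst Bochner_Integration.integral_add)
           (auto simp: less_top[symmetric] Q.prob_space[unfolded sp] sp Int_absorb1 Int_absorb2)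
      also have "\<dots> \<le> \<bar>k - of_rat r\<bar> + K * measure Q ?C"
        by (intro add_left_mono mult_right_mono K) auto
      also have "\<dots> < e / 2 + K * (e / (2 * K))"
        using r \<delta>(2)[OF C \<open>measure M ?C < \<delta>\<close> Q]
        by (intro add_strict_mono mult_strict_left_mono) (use K in auto)
      also have "\<dots> = e"
        by (use K in \<open>simp add: field_simps\<close>)
      finally show ?thesis .
    qed
    then show "\<exists>l. \<forall>Q\<in>\<Q>. (\<integral>\<omega>. \<bar>k * indicator A (Z \<omega>) - rational_step B l (Z \<omega>)\<bar> \<partial>Q) < e"
      by blast
  qed
  have approx_simple: "g \<in> L \<and> approx g" if g: "simple_function MZ g" for g :: "'a \<Rightarrow> real"
  proof -
    let ?s = "\<lambda>F z. \<Sum>y\<in>F. y * indicator (g -` {y} \<inter> space MZ) z"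
    have "?s F \<in> L \<and> approx (?s F)" if "finite F" "F \<subseteq> g ` space MZ" for F
      using that
    proof (induction F rule: finite_induct)
      case empty
      show ?case
        using indicator_L[of "{}" 0] approx_indicator[of "{}" 0] by simp
    next
      case (insert y F)
      have y: "g -` {y} \<inter> space MZ \<in> sets MZ"
        using g insert.prems by (auto simp: simple_function_def)
      have "?s (insert y F) = (\<lambda>z. y * indicator (g -` {y} \<inter> space MZ) z + ?s F z)"
        by (rule ext) (rule sum.insert[OF insert.hyps])
      moreover have F: "?s F \<in> L" "approx (?s F)"
        using insert by blast+
      ultimately show ?case
        using L_add[OF indicator_L[OF y] F(1)] approx_add[OF indicator_L[OF y] F(1) approx_indicator[OF y] F(2)]
        by (simp only: simp_thms)
    qed
    then have s: "?s (g ` space MZ) \<in> L \<and> approx (?s (g ` space MZ))"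
      using g by (simp add: simple_function_def)
    have eq: "g z = ?s (g ` space MZ) z" if "z \<in> space MZ" for z
    proof -
      have "g z = (\<Sum>y\<in>g ` space MZ. indicator (g -` {y} \<inter> space MZ) z *\<^sub>R y)"
        by (rule simple_function_indicator_representation_banach[OF g that])
      also have "\<dots> = ?s (g ` space MZ) z"
        by (intro sum.cong refl) simp
      finally show ?thesis .
    qed
    \<comment> \<open>The representation of \<open>g\<close> is valid on \<open>space MZ\<close>
      only, so it is transferred to the compositions with \<open>Z\<close>, where the integrals
      live.\<close>
    have eqZ: "g (Z \<omega>) = ?s (g ` space MZ) (Z \<omega>)" if "\<omega> \<in> space M" for \<omega>
      by (rule eq[OF measurable_space[OF Z that]])
    have [measurable]: "g \<in> borel_measurable MZ"
      using g by (rule borel_measurable_simple_function)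
    have "(\<lambda>\<omega>. ?s (g ` space MZ) (Z \<omega>)) \<in> Lp_space M (ereal p)"
      using s unfolding L_def by blast
    then have "(\<lambda>\<omega>. g (Z \<omega>)) \<in> Lp_space M (ereal p)"
      using p_nonneg
    proof (rule Lp_space_dominated)
      show "(\<lambda>\<omega>. g (Z \<omega>)) \<in> borel_measurable M"
        by measurable
    qed (simp only: eqZ order_refl)
    then have "g \<in> L"
      by (simp add: L_def)
    moreover have "approx g"
      unfolding approx_def
    proof (intro allI impI)
      fix e :: real assume "0 < e"
      then obtain l where l: "\<forall>Q\<in>\<Q>. (\<integral>\<omega>. \<bar>?s (g ` space MZ) (Z \<omega>) - rational_step B l (Z \<omega>)\<bar> \<partial>Q) < e"
        using s unfolding approx_def by meson
      have "(\<integral>\<omega>. \<bar>g (Z \<omega>) - rational_step B l (Z \<omega>)\<bar> \<partial>Q) =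
          (\<integral>\<omega>. \<bar>?s (g ` space MZ) (Z \<omega>) - rational_step B l (Z \<omega>)\<bar> \<partial>Q)" if "Q \<in> \<Q>" for Q
        by (intro Bochner_Integration.integral_cong refl)
          (simp only: dual_set_space[OF that] eqZ[symmetric])
      with l show "\<exists>l. \<forall>Q\<in>\<Q>. (\<integral>\<omega>. \<bar>g (Z \<omega>) - rational_step B l (Z \<omega>)\<bar> \<partial>Q) < e"
        by (metis (no_types, lifting))
    qed
    ultimately show ?thesis ..
  qed
  have "f \<in> L"
    using fLp by (simp add: L_def)
  moreover have "\<exists>g\<in>L. approx g \<and> (\<forall>Q\<in>\<Q>. (\<integral>\<omega>. \<bar>f (Z \<omega>) - g (Z \<omega>)\<bar> \<partial>Q) < e)" if "0 < e" for e
  proof -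
    obtain s where s: "\<And>i. simple_function MZ (s i)"
        "\<And>z. z \<in> space MZ \<Longrightarrow> (\<lambda>i. s i z) \<longlonglongrightarrow> f z"
        "\<And>i z. z \<in> space MZ \<Longrightarrow> dist (s i z) 0 \<le> 2 * dist (f z) 0"
      using borel_measurable_implies_sequence_metric[OF f, of 0] by blast
    have [measurable]: "s i \<in> borel_measurable MZ" for i
      using s(1) by (rule borel_measurable_simple_function)
    \<comment> \<open>The simple functions satisfy |s i| \<le> 2 |f|, hence |f - s i| \<le> 3
      |f|.\<close>
    have "(\<lambda>\<omega>. 3 * \<bar>f (Z \<omega>)\<bar>) \<in> Lp_space M (ereal p)"
      by (intro Lp_space_cmult Lp_space_abs fLp p_nonneg)
    then have "\<exists>n. \<forall>Q\<in>\<Q>. (\<integral>\<omega>. \<bar>f (Z \<omega>) - s n (Z \<omega>)\<bar> \<partial>Q) < e"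
    proof (rule uniform_dominated_convergence_dual_set[rotated])
      fix \<omega> n assume "\<omega> \<in> space M"
      then have *: "Z \<omega> \<in> space MZ"
        by (rule measurable_space[OF Z])
      show "\<bar>f (Z \<omega>) - s n (Z \<omega>)\<bar> \<le> 3 * \<bar>f (Z \<omega>)\<bar>"
        using s(3)[OF *, of n] by (simp add: dist_real_def)
      show "(\<lambda>n. f (Z \<omega>) - s n (Z \<omega>)) \<longlonglongrightarrow> 0"
        using tendsto_diff[OF tendsto_const[of "f (Z \<omega>)"] s(2)[OF *]] by simp
    qed (use \<open>0 < e\<close> in measurable)
    then show ?thesis
      using approx_simple[OF s(1)] by blast
  qed
  ultimately have "approx f"
    by (rule approx_lim)
  with \<open>0 < \<epsilon>\<close> show ?thesis
    by (simp add: approx_def)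
qed

text \<open>One sequence serves all \<open>f\<close> at once. Its members are maximising measures
  for the countably many step functions: if a step function is within \<epsilon>/2 of
  \<open>f\<close> uniformly over \<open>\<Q>\<close>, its maximiser is \<epsilon>-optimal for
  \<open>f\<close>.\<close>

lemma countable_norming_sequence:
  assumes Z[measurable]: "Z \<in> M \<rightarrow>\<^sub>M MZ" and sep: "separable_measure (distr M MZ Z)"
  shows "\<exists>Qs :: nat \<Rightarrow> 'o measure. range Qs \<subseteq> \<Q> \<and>
    (\<forall>f\<in>borel_measurable MZ. (\<lambda>\<omega>. f (Z \<omega>)) \<in> Lp_space M (ereal p) \<longrightarrow>
      (\<forall>\<epsilon>>0. \<exists>k. \<rho> (\<lambda>\<omega>. f (Z \<omega>)) < ereal ((\<integral>\<omega>. f (Z \<omega>) \<partial>Qs k) + \<epsilon>)))"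
proof -
  obtain \<C> where \<C>: "countable \<C>" "\<C> \<subseteq> sets MZ"
      "\<And>A \<epsilon>. A \<in> sets MZ \<Longrightarrow> \<epsilon> > 0 \<Longrightarrow> \<exists>C\<in>\<C>. measure (distr M MZ Z) (sym_diff A C) < \<epsilon>"
    using sep by (auto simp: separable_measure_def)
  \<comment> \<open>Some member approximates the empty set; nonemptiness is what allows an
    enumeration by \<open>from_nat_into\<close>.\<close>
  have "\<C> \<noteq> {}"
    using \<C>(3)[of "{}" 1] by auto
  define B where "B = from_nat_into \<C>"
  have B[measurable]: "B j \<in> sets MZ" for j
    using \<C>(2) \<open>\<C> \<noteq> {}\<close> from_nat_into[of \<C> j] by (auto simp: B_def)
  have dense: "\<exists>j. measure (distr M MZ Z) (sym_diff A (B j)) < \<epsilon>" if "A \<in> sets MZ" "0 < \<epsilon>" for A \<epsilon>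
    using \<C>(3)[OF that] from_nat_into_surj[OF \<C>(1)] unfolding B_def by metis
  let ?g = "\<lambda>l \<omega>. rational_step B l (Z \<omega>)"
  have g: "?g l \<in> Lp_space M (ereal p)" for l
    by (rule rational_step_Lp[OF Z B])
  have "\<exists>R. \<forall>l. R l \<in> \<Q> \<and> \<rho> (?g l) = ereal (\<integral>\<omega>. ?g l \<omega> \<partial>R l)"
    by (intro choice allI) (use rho_attained[OF g] in \<open>simp add: Bex_def\<close>)
  then obtain R where R: "\<And>l. R l \<in> \<Q>" "\<And>l. \<rho> (?g l) = ereal (\<integral>\<omega>. ?g l \<omega> \<partial>R l)"
    by auto
  have "\<exists>l. \<rho> (\<lambda>\<omega>. f (Z \<omega>)) < ereal ((\<integral>\<omega>. f (Z \<omega>) \<partial>R l) + \<epsilon>)"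
    if f[measurable]: "f \<in> borel_measurable MZ" and fLp: "(\<lambda>\<omega>. f (Z \<omega>)) \<in> Lp_space M (ereal p)"
      and "0 < \<epsilon>" for f \<epsilon>
  proof -
    obtain l where l: "\<And>Q. Q \<in> \<Q> \<Longrightarrow> (\<integral>\<omega>. \<bar>f (Z \<omega>) - ?g l \<omega>\<bar> \<partial>Q) < \<epsilon> / 2"
      using uniform_rational_step_approximation[OF Z B dense f fLp, of "\<epsilon> / 2"] \<open>0 < \<epsilon>\<close> by auto
    have close: "\<bar>(\<integral>\<omega>. f (Z \<omega>) \<partial>Q) - (\<integral>\<omega>. ?g l \<omega> \<partial>Q)\<bar> < \<epsilon> / 2" if Q: "Q \<in> \<Q>" for Q
    proof -
      have "\<bar>\<integral>\<omega>. f (Z \<omega>) - ?g l \<omega> \<partial>Q\<bar> \<le> (\<integral>\<omega>. \<bar>f (Z \<omega>) - ?g l \<omega>\<bar> \<partial>Q)"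
        using integral_norm_bound[of Q "\<lambda>\<omega>. f (Z \<omega>) - ?g l \<omega>"] by simp
      then show ?thesis
        using l[OF Q] dual_set_integrable[OF Q fLp] dual_set_integrable[OF Q g] by simp
    qed
    obtain Q where Q: "Q \<in> \<Q>" "\<rho> (\<lambda>\<omega>. f (Z \<omega>)) = ereal (\<integral>\<omega>. f (Z \<omega>) \<partial>Q)"
      using rho_attained[OF fLp] by auto
    \<comment> \<open>Nothing is lost at the step function, where \<open>R l\<close> is optimal; the
      passage from \<open>f\<close> to it and back costs less than \<epsilon>/2 each.\<close>
    have "(\<integral>\<omega>. ?g l \<omega> \<partial>Q) \<le> (\<integral>\<omega>. ?g l \<omega> \<partial>R l)"
      using integral_le_rho[OF Q(1) g[of l]] R(2)[of l] by simp
    then have "(\<integral>\<omega>. f (Z \<omega>) \<partial>Q) < (\<integral>\<omega>. f (Z \<omega>) \<partial>R l) + \<epsilon>"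
      using close[OF Q(1)] close[OF R(1)[of l]] by linarith
    then show ?thesis
      unfolding Q(2) by auto
  qed
  then have "\<exists>k. \<rho> (\<lambda>\<omega>. f (Z \<omega>)) < ereal ((\<integral>\<omega>. f (Z \<omega>) \<partial>R (from_nat k)) + \<epsilon>)"
    if "f \<in> borel_measurable MZ" "(\<lambda>\<omega>. f (Z \<omega>)) \<in> Lp_space M (ereal p)" "0 < \<epsilon>" for f \<epsilon>
    using that by (metis from_nat_to_nat)
  with R(1) show ?thesis
    by (intro exI[of _ "\<lambda>k. R (from_nat k)"]) auto
qed

end

section \<open>One-step formula for the law of motion\<close>

lemma
  fixes E :: "'e::topological_space set"
  defines "B \<equiv> restrict_space borel E"
  assumes IT: "Ionescu_Tulcea (path_kernel E T Z \<pi> \<gamma> x) (\<lambda>_. B)"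
  shows sets_law_of_motion: "sets (law_of_motion E T Z \<pi> \<gamma> x) = sets (PiM UNIV (\<lambda>_. B))"
    and prob_space_law_of_motion: "prob_space (law_of_motion E T Z \<pi> \<gamma> x)"
proof -
  interpret IT: Ionescu_Tulcea "path_kernel E T Z \<pi> \<gamma> x" "\<lambda>_. B" by fact
  show sets: "sets (law_of_motion E T Z \<pi> \<gamma> x) = sets (PiM UNIV (\<lambda>_. B))"
    unfolding law_of_motion_def B_def[symmetric] by simp
  \<comment> \<open>The projection to the empty set of coordinates retains exactly the total
    mass.\<close>
  have "distr (law_of_motion E T Z \<pi> \<gamma> x) (PiM {0..<0} (\<lambda>_. B)) (\<lambda>X. restrict X {0..<0}) =
      IT.C 0 0 (\<lambda>_. undefined)"
    unfolding B_def by (rule law_of_motion_finite_dim) (use IT B_def in simp)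
  moreover have "prob_space (IT.C 0 0 (\<lambda>_. undefined))"
    by (rule IT.prob_space_C) simp
  ultimately have "prob_space (distr (law_of_motion E T Z \<pi> \<gamma> x) (PiM {0..<0} (\<lambda>_. B)) (\<lambda>X. restrict X {0..<0}))"
    by (simp only:)
  then show "prob_space (law_of_motion E T Z \<pi> \<gamma> x)"
    by (rule prob_space_distrD[rotated]) (simp add: measurable_cong_sets[OF sets refl] measurable_restrict_subset)
qed

lemma nn_integral_law_of_motion_restrict:
  fixes E :: "'e::topological_space set"
  defines "B \<equiv> restrict_space borel E"
  assumes IT: "Ionescu_Tulcea (path_kernel E T Z \<pi> \<gamma> x) (\<lambda>_. B)"
    and f: "f \<in> borel_measurable (PiM {0..<n} (\<lambda>_. B))"
  shows "(\<integral>\<^sup>+X. f (restrict X {0..<n}) \<partial>law_of_motion E T Z \<pi> \<gamma> x) =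
    (\<integral>\<^sup>+h. f h \<partial>Ionescu_Tulcea.C (path_kernel E T Z \<pi> \<gamma> x) (\<lambda>_. B) 0 n (\<lambda>_. undefined))"
proof -
  have IT': "Ionescu_Tulcea (path_kernel E T Z \<pi> \<gamma> x) (\<lambda>_. restrict_space borel E)"
    using IT by (simp add: B_def)
  have [measurable_cong]: "sets (law_of_motion E T Z \<pi> \<gamma> x) = sets (PiM UNIV (\<lambda>_. B))"
    unfolding B_def by (rule sets_law_of_motion[OF IT'])
  show ?thesis
    using law_of_motion_finite_dim[OF IT', of n, symmetric] f
    by (simp add: B_def[symmetric] nn_integral_distr measurable_restrict_subset
        measurable_cong_sets[OF \<open>sets (law_of_motion E T Z \<pi> \<gamma> x) = sets (PiM UNIV (\<lambda>_. B))\<close> refl])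
qed

lemma nn_integral_law_of_motion_0:
  fixes E :: "'e::topological_space set"
  defines "B \<equiv> restrict_space borel E"
  assumes IT: "Ionescu_Tulcea (path_kernel E T Z \<pi> \<gamma> x) (\<lambda>_. B)"
    and x: "x \<in> E" and f[measurable]: "f \<in> borel_measurable B"
  shows "(\<integral>\<^sup>+X. f (X 0) \<partial>law_of_motion E T Z \<pi> \<gamma> x) = f x"
proof -
  interpret IT: Ionescu_Tulcea "path_kernel E T Z \<pi> \<gamma> x" "\<lambda>_. B" by fact
  have IT': "Ionescu_Tulcea (path_kernel E T Z \<pi> \<gamma> x) (\<lambda>_. restrict_space borel E)"
    using IT by (simp add: B_def)
  have xB: "x \<in> space B"
    using x by (simp add: B_def space_restrict_space)
  \<comment> \<open>The empty history, which is the only point of the product over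
    \<open>{0..<0}\<close>.\<close>
  let ?u = "\<lambda>_::nat. undefined :: 'e"
  have u: "?u \<in> space (PiM {0..<0} (\<lambda>_. B))"
    by simp
  have "(\<integral>\<^sup>+X. f (X 0) \<partial>law_of_motion E T Z \<pi> \<gamma> x) =
      (\<integral>\<^sup>+X. f (restrict X {0..<Suc 0} 0) \<partial>law_of_motion E T Z \<pi> \<gamma> x)"
    by simp
  also have "\<dots> = (\<integral>\<^sup>+h. f (h 0) \<partial>IT.C 0 (Suc 0) ?u)"
    unfolding B_def by (rule nn_integral_law_of_motion_restrict[OF IT']) (simp add: B_def[symmetric])
  also have "\<dots> = (\<integral>\<^sup>+h. f (h 0) \<partial>IT.eP 0 ?u)"
    using bind_return[OF IT.measurable_eP u] by simp
  also have "\<dots> = (\<integral>\<^sup>+y. f y \<partial>return B x)"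
    by (subst IT.nn_integral_eP[OF u]) (auto simp: path_kernel_def B_def[symmetric])
  also have "\<dots> = f x"
    by (rule nn_integral_return[OF xB f])
  finally show ?thesis .
qed

text \<open>The Markov property: only the last kernel is integrated out, and it depends on the
  history through the present state. Nonnegative integrals avoid any integrability hypothesis, and
  integrability can later be deduced from this very formula.\<close>

lemma nn_integral_law_of_motion_Suc:
  fixes E :: "'e::topological_space set"
  defines "B \<equiv> restrict_space borel E"
  assumes IT: "Ionescu_Tulcea (path_kernel E T Z \<pi> \<gamma> x) (\<lambda>_. B)"
    and K: "transition_kernel E T Z \<pi> \<gamma> n \<in> B \<rightarrow>\<^sub>M subprob_algebra B"
    and f[measurable]: "f \<in> borel_measurable (B \<Otimes>\<^sub>M B)"
  shows "(\<integral>\<^sup>+X. f (X n, X (Suc n)) \<partial>law_of_motion E T Z \<pi> \<gamma> x) =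
    (\<integral>\<^sup>+X. (\<integral>\<^sup>+y. f (X n, y) \<partial>transition_kernel E T Z \<pi> \<gamma> n (X n)) \<partial>law_of_motion E T Z \<pi> \<gamma> x)"
proof -
  interpret IT: Ionescu_Tulcea "path_kernel E T Z \<pi> \<gamma> x" "\<lambda>_. B" by fact
  have IT': "Ionescu_Tulcea (path_kernel E T Z \<pi> \<gamma> x) (\<lambda>_. restrict_space borel E)"
    using IT by (simp add: B_def)
  note K[measurable]
  let ?K = "transition_kernel E T Z \<pi> \<gamma> n"
  let ?u = "\<lambda>_::nat. undefined :: 'e"
  have u: "?u \<in> space (PiM {0..<0} (\<lambda>_. B))"
    by simp
  have C_space: "space (IT.C 0 (Suc n) ?u) = space (PiM {0..<Suc n} (\<lambda>_. B))"
    using IT.space_C[OF u, of "Suc n"] by simp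
  have C_sets: "sets (IT.C 0 (Suc n) ?u) = sets (PiM {0..<Suc n} (\<lambda>_. B))"
    using IT.sets_C[OF u, of "Suc n"] by simp
  have f2: "(\<lambda>h. f (h n, h (Suc n))) \<in> borel_measurable (PiM {0..<Suc (Suc n)} (\<lambda>_. B))"
    by measurable
  have f1: "(\<lambda>h. \<integral>\<^sup>+y. f (h n, y) \<partial>?K (h n)) \<in> borel_measurable (PiM {0..<Suc n} (\<lambda>_. B))"
    by (rule nn_integral_measurable_subprob_algebra2[where N=B]) measurable
  have "(\<integral>\<^sup>+X. f (X n, X (Suc n)) \<partial>law_of_motion E T Z \<pi> \<gamma> x) =
      (\<integral>\<^sup>+X. f (restrict X {0..<Suc (Suc n)} n, restrict X {0..<Suc (Suc n)} (Suc n)) \<partial>law_of_motion E T Z \<pi> \<gamma> x)"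
    by simp
  also have "\<dots> = (\<integral>\<^sup>+h. f (h n, h (Suc n)) \<partial>IT.C 0 (Suc (Suc n)) ?u)"
    unfolding B_def by (rule nn_integral_law_of_motion_restrict[OF IT']) (use f2 B_def in simp)
  \<comment> \<open>\<open>C 0 (Suc (Suc n))\<close> binds \<open>eP (Suc n)\<close>, whose path
    kernel at index \<open>Suc n\<close> is the transition kernel with index \<open>n\<close>: index
    0 is taken by the initial state.\<close>
  also have "\<dots> = (\<integral>\<^sup>+h. \<integral>\<^sup>+h'. f (h' n, h' (Suc n)) \<partial>IT.eP (Suc n) h \<partial>IT.C 0 (Suc n) ?u)"
    by (subst IT.C.simps, subst nn_integral_bind[OF f2])
      (auto simp: measurable_cong_sets[OF C_sets refl] IT.measurable_eP simp del: IT.C.simps)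
  also have "\<dots> = (\<integral>\<^sup>+h. (\<integral>\<^sup>+y. f (h n, y) \<partial>?K (h n)) \<partial>IT.C 0 (Suc n) ?u)"
  proof (rule nn_integral_cong)
    fix h assume "h \<in> space (IT.C 0 (Suc n) ?u)"
    then have h: "h \<in> space (PiM {0..<Suc n} (\<lambda>_. B))"
      unfolding C_space .
    show "(\<integral>\<^sup>+h'. f (h' n, h' (Suc n)) \<partial>IT.eP (Suc n) h) = (\<integral>\<^sup>+y. f (h n, y) \<partial>?K (h n))"
      by (subst IT.nn_integral_eP[OF h f2]) (simp add: path_kernel_def)
  qed
  also have "\<dots> = (\<integral>\<^sup>+X. (\<integral>\<^sup>+y. f (restrict X {0..<Suc n} n, y) \<partial>?K (restrict X {0..<Suc n} n))
      \<partial>law_of_motion E T Z \<pi> \<gamma> x)"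
    unfolding B_def by (rule nn_integral_law_of_motion_restrict[OF IT', symmetric]) (use f1 B_def in simp)
  finally show ?thesis
    by simp
qed

section \<open>Value of a fixed policy\<close>

text \<open>The lower and upper bounds are merged into one weight \<open>b\<close>, and bounds on
  risks become bounds on integrals under every member of \<open>\<Q>\<close>. In this form growth
  estimates are linear and can be iterated along a path.\<close>

locale risk_decision_model = dual_risk_measure M p q \<rho> \<Q>
  for M :: "'o measure" and p q \<rho> \<Q> +
  fixes E :: "'e::polish_space set" and A :: "'a::polish_space set" and D :: "('e \<times> 'a) set"
    and MZ :: "'z measure" and Z :: "'o \<Rightarrow> 'z" and T :: "'e \<Rightarrow> 'a \<Rightarrow> 'z \<Rightarrow> 'e"
    and c :: "'e \<Rightarrow> 'a \<Rightarrow> 'e \<Rightarrow> real" and b :: "'e \<Rightarrow> real" and \<alpha> \<beta> :: real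
  assumes T_meas: "(\<lambda>((x, a), z). T x a z) \<in>
        restrict_space borel D \<Otimes>\<^sub>M MZ \<rightarrow>\<^sub>M restrict_space borel E"
    and c_meas: "(\<lambda>((x, a), y). c x a y) \<in>
        borel_measurable (restrict_space borel D \<Otimes>\<^sub>M restrict_space borel E)"
    and Z_meas[measurable]: "Z \<in> M \<rightarrow>\<^sub>M MZ"
    and Z_separable: "separable_measure (distr M MZ Z)"
    and b_meas[measurable]: "b \<in> borel_measurable (restrict_space borel E)"
    and b_nonneg: "\<And>x. x \<in> E \<Longrightarrow> 0 \<le> b x"
    and alpha_nonneg: "0 \<le> \<alpha>" and beta_pos: "0 < \<beta>" and contraction: "\<alpha> * \<beta> < 1"
    and cost_Lp: "\<And>x a. (x, a) \<in> D \<Longrightarrow> (\<lambda>\<omega>. c x a (T x a (Z \<omega>))) \<in> Lp_space M (ereal p)"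
    and b_Lp: "\<And>x a. (x, a) \<in> D \<Longrightarrow> (\<lambda>\<omega>. b (T x a (Z \<omega>))) \<in> Lp_space M (ereal p)"
    and cost_bound: "\<And>x a Q. (x, a) \<in> D \<Longrightarrow> Q \<in> \<Q> \<Longrightarrow> (\<integral>\<omega>. \<bar>c x a (T x a (Z \<omega>))\<bar> \<partial>Q) \<le> b x"
    and b_bound: "\<And>x a Q. (x, a) \<in> D \<Longrightarrow> Q \<in> \<Q> \<Longrightarrow> (\<integral>\<omega>. b (T x a (Z \<omega>)) \<partial>Q) \<le> \<alpha> * b x"
    and finite_values_meas: "\<And>\<pi> n. \<pi> \<in> markov_policies E A D \<Longrightarrow>
        finite_policy_value \<rho> c T Z \<beta> n \<pi> \<in> borel_measurable (restrict_space borel E)"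
begin

abbreviation "B \<equiv> restrict_space borel E :: 'e measure"

abbreviation "\<Gamma> \<equiv> nature_policies D (dual_borel M (ereal p) q \<Q>)"

abbreviation "law \<pi> \<gamma> x \<equiv> law_of_motion E T Z \<pi> \<gamma> x"

lemma space_B [simp]: "space B = E"
  by (simp add: space_restrict_space)

lemma space_D [simp]: "space (restrict_space borel D) = D"
  by (simp add: space_restrict_space)

lemma space_dual_borel [simp]: "space (dual_borel M (ereal p) q \<Q>) = \<Q>"
  unfolding dual_borel_def by (rule space_measure_of) (auto simp: openin_subtopology)

section \<open>Measurability of transitions, costs and kernels\<close>

lemma transition_measurable:
  "(\<lambda>(s, \<omega>). T (fst s) (snd s) (Z \<omega>)) \<in> restrict_space borel D \<Otimes>\<^sub>M M \<rightarrow>\<^sub>M B"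
proof -
  have "(\<lambda>(s, \<omega>). (s, Z \<omega>)) \<in> restrict_space borel D \<Otimes>\<^sub>M M \<rightarrow>\<^sub>M restrict_space borel D \<Otimes>\<^sub>M MZ"
    by measurable
  from measurable_comp[OF this T_meas] show ?thesis
    by (simp add: comp_def case_prod_beta)
qed

lemma transition_noise_measurable:
  assumes "(x, a) \<in> D"
  shows "T x a \<in> MZ \<rightarrow>\<^sub>M B"
  using measurable_compose[OF measurable_Pair1'[of "(x, a)" "restrict_space borel D" MZ] T_meas] assms
  by simp

lemma transition_in_E: "(x, a) \<in> D \<Longrightarrow> \<omega> \<in> space M \<Longrightarrow> T x a (Z \<omega>) \<in> E"
  using measurable_space[OF transition_noise_measurable, of x a "Z \<omega>"] measurable_space[OF Z_meas]
  by simp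

lemma cost_noise_measurable:
  assumes "(x, a) \<in> D"
  shows "(\<lambda>z. c x a (T x a z)) \<in> borel_measurable MZ"
  using measurable_compose[OF measurable_compose[OF transition_noise_measurable[OF assms]
        measurable_Pair1'[of "(x, a)" "restrict_space borel D" B]] c_meas] assms
  by simp

lemma rule_measurable:
  assumes "d \<in> markov_rules E A D"
  shows "(\<lambda>x. (x, d x)) \<in> B \<rightarrow>\<^sub>M restrict_space borel D"
proof (rule measurable_restrict_space2)
  show "(\<lambda>x. (x, d x)) \<in> space B \<rightarrow> D"
    using assms by (auto simp: markov_rules_def)
  have "d \<in> B \<rightarrow>\<^sub>M borel"
    using assms by (auto simp: markov_rules_def dest: measurable_restrict_space2_iff[THEN iffD1])
  moreover have "(\<lambda>x. x) \<in> B \<rightarrow>\<^sub>M borel"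
    by (rule measurable_restrict_space1) simp
  ultimately show "(\<lambda>x. (x, d x)) \<in> borel_measurable B"
    unfolding borel_prod[symmetric] by (intro measurable_Pair)
qed

lemma policy_rule: "\<pi> \<in> markov_policies E A D \<Longrightarrow> \<pi> n \<in> markov_rules E A D"
  by (simp add: markov_policies_def)

lemma policy_in_D: "\<pi> \<in> markov_policies E A D \<Longrightarrow> x \<in> E \<Longrightarrow> (x, \<pi> n x) \<in> D"
  using policy_rule[of \<pi> n] by (simp add: markov_rules_def)

lemma policy_measurable:
  "\<pi> \<in> markov_policies E A D \<Longrightarrow> (\<lambda>x. (x, \<pi> n x)) \<in> B \<rightarrow>\<^sub>M restrict_space borel D"
  by (intro rule_measurable policy_rule)

lemma policy_shift:
  "\<pi> \<in> markov_policies E A D \<Longrightarrow> (\<lambda>k. \<pi> (n + k)) \<in> markov_policies E A D"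
  by (simp add: markov_policies_def)

lemma policy_cost_measurable:
  assumes "\<pi> \<in> markov_policies E A D"
  shows "(\<lambda>(x, y). c x (\<pi> n x) y) \<in> borel_measurable (B \<Otimes>\<^sub>M B)"
proof -
  have "(\<lambda>(x, y). ((x, \<pi> n x), y)) \<in> B \<Otimes>\<^sub>M B \<rightarrow>\<^sub>M restrict_space borel D \<Otimes>\<^sub>M B"
    using measurable_compose[OF measurable_fst policy_measurable[OF assms, of n], of B]
    by (auto simp: case_prod_beta intro!: measurable_Pair)
  from measurable_comp[OF this c_meas] show ?thesis
    by (simp add: comp_def case_prod_beta)
qed

text \<open>Indicators belong to L^p, so Q \<mapsto> Q(S) is weakly Borel. Hence every measurable
  map into \<open>\<Q>\<close> is a stochastic kernel, and nature's policies produce transition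
  kernels.\<close>

lemma dual_borel_subprob: "(\<lambda>Q. Q) \<in> dual_borel M (ereal p) q \<Q> \<rightarrow>\<^sub>M subprob_algebra M"
proof (rule measurable_subprob_algebra)
  fix S assume S: "S \<in> sets M"
  have "(indicator S :: 'o \<Rightarrow> real) \<in> Lp_space M (ereal p)"
    by (rule Lp_space_bounded[where C=1])
      (use S in \<open>auto simp: p_nonneg finite_measure_axioms indicator_def\<close>)
  then have "(\<lambda>Q. ennreal (\<integral>\<omega>. indicator S \<omega> \<partial>Q)) \<in> borel_measurable (dual_borel M (ereal p) q \<Q>)"
    using measurable_integral_dual_borel by measurable
  moreover have "emeasure Q S = ennreal (\<integral>\<omega>. indicator S \<omega> \<partial>Q)" if Q: "Q \<in> \<Q>" for Q
  proof -
    interpret Q: prob_space Q by (rule dual_setD[OF Q])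
    show ?thesis
      using S dual_setD(2)[OF Q] by (simp add: Q.emeasure_eq_measure)
  qed
  ultimately show "(\<lambda>Q. emeasure Q S) \<in> borel_measurable (dual_borel M (ereal p) q \<Q>)"
    by (subst measurable_cong[where g="\<lambda>Q. ennreal (\<integral>\<omega>. indicator S \<omega> \<partial>Q)"]) auto
qed (auto simp: dual_setD prob_space_imp_subprob_space)

lemma nature_in_dual_set: "\<gamma> \<in> \<Gamma> \<Longrightarrow> s \<in> D \<Longrightarrow> \<gamma> n s \<in> \<Q>"
  using measurable_space[of "\<gamma> n" "restrict_space borel D" "dual_borel M (ereal p) q \<Q>" s]
  by (simp add: nature_policies_def)

lemma transition_kernel_measurable:
  assumes \<pi>: "\<pi> \<in> markov_policies E A D" and \<gamma>: "\<gamma> \<in> \<Gamma>"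
  shows "transition_kernel E T Z \<pi> \<gamma> n \<in> B \<rightarrow>\<^sub>M subprob_algebra B"
  unfolding transition_kernel_def
proof (rule measurable_distr2)
  have "\<gamma> n \<in> restrict_space borel D \<rightarrow>\<^sub>M subprob_algebra M"
    using measurable_compose[of "\<gamma> n" "restrict_space borel D", OF _ dual_borel_subprob] \<gamma> by (simp add: nature_policies_def)
  from measurable_compose[OF policy_measurable[OF \<pi>] this]
  show "(\<lambda>x. \<gamma> n (x, \<pi> n x)) \<in> B \<rightarrow>\<^sub>M subprob_algebra M" .
  have "(\<lambda>(x, \<omega>). ((x, \<pi> n x), \<omega>)) \<in> B \<Otimes>\<^sub>M M \<rightarrow>\<^sub>M restrict_space borel D \<Otimes>\<^sub>M M"
    using measurable_compose[OF measurable_fst policy_measurable[OF \<pi>, of n], of M]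
    by (auto simp: case_prod_beta intro!: measurable_Pair)
  from measurable_comp[OF this transition_measurable]
  show "(\<lambda>(x, \<omega>). T x (\<pi> n x) (Z \<omega>)) \<in> B \<Otimes>\<^sub>M M \<rightarrow>\<^sub>M B"
    by (simp add: comp_def case_prod_beta)
qed

lemma transition_noise_measurable_dual:
  assumes "s \<in> D" "Q \<in> \<Q>"
  shows "(\<lambda>\<omega>. T (fst s) (snd s) (Z \<omega>)) \<in> Q \<rightarrow>\<^sub>M B"
  using measurable_compose[OF Z_meas transition_noise_measurable[of "fst s" "snd s"]] assms
  by (simp add: measurable_cong_sets[OF dual_setD(2)[OF assms(2)] refl])

lemma prob_space_transition_kernel:
  assumes "\<pi> \<in> markov_policies E A D" "\<gamma> \<in> \<Gamma>" "x \<in> E"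
  shows "prob_space (transition_kernel E T Z \<pi> \<gamma> n x)"
  unfolding transition_kernel_def
  using transition_noise_measurable_dual[of "(x, \<pi> n x)"] nature_in_dual_set[of \<gamma> "(x, \<pi> n x)" n]
    policy_in_D[of \<pi> x n] assms
  by (intro prob_space.prob_space_distr) (auto simp: dual_setD)

text \<open>\<open>law_of_motion\<close> is a total term; this predicate is what gives access to its
  finite-dimensional distributions and total mass.\<close>

lemma Ionescu_Tulcea_path_kernel:
  assumes \<pi>: "\<pi> \<in> markov_policies E A D" and \<gamma>: "\<gamma> \<in> \<Gamma>" and x: "x \<in> E"
  shows "Ionescu_Tulcea (path_kernel E T Z \<pi> \<gamma> x) (\<lambda>_. B)"
proof (rule Ionescu_Tulcea.intro)
  fix n :: nat
  show "path_kernel E T Z \<pi> \<gamma> x n \<in> PiM {0..<n} (\<lambda>_. B) \<rightarrow>\<^sub>M subprob_algebra B"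
  proof (cases n)
    case 0
    have "return B x \<in> space (subprob_algebra B)"
      using x by (auto simp: space_subprob_algebra intro!: prob_space_imp_subprob_space prob_space_return)
    moreover have "path_kernel E T Z \<pi> \<gamma> x 0 = (\<lambda>_. return B x)"
      by (simp add: path_kernel_def fun_eq_iff)
    ultimately show ?thesis
      by (simp add: 0)
  next
    case (Suc k)
    show ?thesis
      unfolding path_kernel_def Suc
      using measurable_compose[OF measurable_component_singleton[of k "{0..<Suc k}" "\<lambda>_. B"] transition_kernel_measurable[OF \<pi> \<gamma>]]
      by simp
  qed
next
  fix n :: nat and h assume "h \<in> space (PiM {0..<n} (\<lambda>_. B))"
  then show "prob_space (path_kernel E T Z \<pi> \<gamma> x n h)"
    using x by (cases n) (auto simp: path_kernel_def space_PiM
        intro!: prob_space_return prob_space_transition_kernel[OF \<pi> \<gamma>])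
qed

lemma
  assumes "\<pi> \<in> markov_policies E A D" "\<gamma> \<in> \<Gamma>" "x \<in> E"
  shows sets_law: "sets (law \<pi> \<gamma> x) = sets (PiM UNIV (\<lambda>_. B))"
    and prob_space_law: "prob_space (law \<pi> \<gamma> x)"
  by (rule sets_law_of_motion[OF Ionescu_Tulcea_path_kernel[OF assms]],
      rule prob_space_law_of_motion[OF Ionescu_Tulcea_path_kernel[OF assms]])

lemma law_in_E:
  assumes "\<pi> \<in> markov_policies E A D" "\<gamma> \<in> \<Gamma>" "x \<in> E" and "X \<in> space (law \<pi> \<gamma> x)"
  shows "X n \<in> E"
  using assms(4) sets_eq_imp_space_eq[OF sets_law[OF assms(1-3)]] by (auto simp: space_PiM)

lemma law_measurable:
  assumes "\<pi> \<in> markov_policies E A D" "\<gamma> \<in> \<Gamma>" "x \<in> E"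
  shows "(\<lambda>X. X n) \<in> law \<pi> \<gamma> x \<rightarrow>\<^sub>M B"
  using measurable_component_singleton[of n UNIV "\<lambda>_. B"]
  by (simp add: measurable_cong_sets[OF sets_law[OF assms] refl])

lemma nn_integral_transition_kernel:
  assumes "\<pi> \<in> markov_policies E A D" "\<gamma> \<in> \<Gamma>" "x \<in> E" and f: "f \<in> borel_measurable B"
  shows "(\<integral>\<^sup>+y. f y \<partial>transition_kernel E T Z \<pi> \<gamma> n x) =
    (\<integral>\<^sup>+\<omega>. f (T x (\<pi> n x) (Z \<omega>)) \<partial>\<gamma> n (x, \<pi> n x))"
  unfolding transition_kernel_def
  using transition_noise_measurable_dual[of "(x, \<pi> n x)"] nature_in_dual_set[of \<gamma> "(x, \<pi> n x)" n]
    policy_in_D[of \<pi> x n] assms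
  by (intro nn_integral_distr) auto

section \<open>Moments and one-step expectations under a law of motion\<close>

text \<open>Each transition multiplies the expected weight by at most \<alpha>, whichever member of
  \<open>\<Q>\<close> nature selects. The bound is thus uniform in \<open>\<gamma>\<close>.\<close>

lemma moment_bound:
  assumes \<pi>: "\<pi> \<in> markov_policies E A D" and \<gamma>: "\<gamma> \<in> \<Gamma>" and x: "x \<in> E"
  shows "(\<integral>\<^sup>+X. ennreal (b (X n)) \<partial>law \<pi> \<gamma> x) \<le> ennreal (\<alpha> ^ n * b x)"
proof (induction n)
  case 0
  show ?case
    by (subst nn_integral_law_of_motion_0[OF Ionescu_Tulcea_path_kernel[OF assms] x]) auto
next
  case (Suc n)
  have "(\<integral>\<^sup>+X. ennreal (b (X (Suc n))) \<partial>law \<pi> \<gamma> x) =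
      (\<integral>\<^sup>+X. (\<integral>\<^sup>+y. ennreal (b y) \<partial>transition_kernel E T Z \<pi> \<gamma> n (X n)) \<partial>law \<pi> \<gamma> x)"
    using nn_integral_law_of_motion_Suc[OF Ionescu_Tulcea_path_kernel[OF assms]
        transition_kernel_measurable[OF \<pi> \<gamma>, of n], of "\<lambda>(_, y). ennreal (b y)"]
    by simp
  also have "\<dots> \<le> (\<integral>\<^sup>+X. ennreal \<alpha> * ennreal (b (X n)) \<partial>law \<pi> \<gamma> x)"
  proof (rule nn_integral_mono)
    fix X assume "X \<in> space (law \<pi> \<gamma> x)"
    then have X: "X n \<in> E"
      by (rule law_in_E[OF assms])
    let ?a = "\<pi> n (X n)"
    note XD = policy_in_D[OF \<pi> X, of n]
    note Q = nature_in_dual_set[OF \<gamma> XD, of n]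
    have "(\<integral>\<^sup>+y. ennreal (b y) \<partial>transition_kernel E T Z \<pi> \<gamma> n (X n)) =
        (\<integral>\<^sup>+\<omega>. ennreal (b (T (X n) ?a (Z \<omega>))) \<partial>\<gamma> n (X n, ?a))"
      by (rule nn_integral_transition_kernel[OF \<pi> \<gamma> X]) simp
    also have "\<dots> = ennreal (\<integral>\<omega>. b (T (X n) ?a (Z \<omega>)) \<partial>\<gamma> n (X n, ?a))"
      using dual_set_integrable[OF Q b_Lp[OF XD]] b_nonneg transition_in_E[OF XD]
      by (intro nn_integral_eq_integral AE_I2) (auto simp: dual_set_space[OF Q])
    also have "\<dots> \<le> ennreal (\<alpha> * b (X n))"
      using b_bound[OF XD Q] by (rule ennreal_leI)
    finally show "(\<integral>\<^sup>+y. ennreal (b y) \<partial>transition_kernel E T Z \<pi> \<gamma> n (X n)) \<le>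
        ennreal \<alpha> * ennreal (b (X n))"
      using b_nonneg[OF X] alpha_nonneg by (simp add: ennreal_mult)
  qed
  also have "\<dots> = ennreal \<alpha> * (\<integral>\<^sup>+X. ennreal (b (X n)) \<partial>law \<pi> \<gamma> x)"
    using law_measurable[OF assms, of n] by (intro nn_integral_cmult) measurable
  also have "\<dots> \<le> ennreal \<alpha> * ennreal (\<alpha> ^ n * b x)"
    by (intro mult_left_mono Suc) auto
  also have "\<dots> = ennreal (\<alpha> ^ Suc n * b x)"
    using alpha_nonneg b_nonneg[OF x] by (simp add: ennreal_mult[symmetric] mult.assoc)
  finally show ?case .
qed

text \<open>Here \<open>g\<close> is the conditional expectation of G(X_n, X_(n+1)) given X_n. Both
  integrals agree as nonnegative ones and are finite by \<open>moment_bound\<close>; this makes them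
  legitimate real integrals.\<close>

lemma expectation_Suc_nonneg:
  fixes G :: "'e \<Rightarrow> 'e \<Rightarrow> real"
  assumes \<pi>: "\<pi> \<in> markov_policies E A D" and \<gamma>: "\<gamma> \<in> \<Gamma>" and x: "x \<in> E"
    and G[measurable]: "(\<lambda>(x, y). G x y) \<in> borel_measurable (B \<Otimes>\<^sub>M B)"
    and nonneg: "\<And>x y. x \<in> E \<Longrightarrow> y \<in> E \<Longrightarrow> 0 \<le> G x y"
    and GLp: "\<And>x. x \<in> E \<Longrightarrow> (\<lambda>\<omega>. G x (T x (\<pi> n x) (Z \<omega>))) \<in> Lp_space M (ereal p)"
    and bound: "\<And>x Q. x \<in> E \<Longrightarrow> Q \<in> \<Q> \<Longrightarrow> (\<integral>\<omega>. G x (T x (\<pi> n x) (Z \<omega>)) \<partial>Q) \<le> C * b x"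
    and C: "0 \<le> C"
  defines "g \<equiv> \<lambda>x. \<integral>\<omega>. G x (T x (\<pi> n x) (Z \<omega>)) \<partial>\<gamma> n (x, \<pi> n x)"
  shows "integrable (law \<pi> \<gamma> x) (\<lambda>X. G (X n) (X (Suc n)))"
    and "integrable (law \<pi> \<gamma> x) (\<lambda>X. g (X n))"
    and "(\<integral>X. G (X n) (X (Suc n)) \<partial>law \<pi> \<gamma> x) = (\<integral>X. g (X n) \<partial>law \<pi> \<gamma> x)"
    and "(\<integral>X. G (X n) (X (Suc n)) \<partial>law \<pi> \<gamma> x) \<le> C * (\<alpha> ^ n * b x)"
proof -
  let ?P = "law \<pi> \<gamma> x" and ?K = "transition_kernel E T Z \<pi> \<gamma> n"
  note K[measurable] = transition_kernel_measurable[OF \<pi> \<gamma>, of n]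
  note X[measurable] = law_measurable[OF \<pi> \<gamma> x]
  have kernel: "(\<integral>\<^sup>+y. ennreal (G x y) \<partial>?K x) = ennreal (g x)" and g_nonneg: "0 \<le> g x"
    and g_le: "g x \<le> C * b x" if x: "x \<in> E" for x
  proof -
    note xD = policy_in_D[OF \<pi> x, of n]
    note Q = nature_in_dual_set[OF \<gamma> xD, of n]
    have "(\<lambda>y. ennreal (G x y)) \<in> borel_measurable B"
      using measurable_compose[OF measurable_Pair1'[of x B B] G] x by simp
    then have "(\<integral>\<^sup>+y. ennreal (G x y) \<partial>?K x) =
        (\<integral>\<^sup>+\<omega>. ennreal (G x (T x (\<pi> n x) (Z \<omega>))) \<partial>\<gamma> n (x, \<pi> n x))"
      by (rule nn_integral_transition_kernel[OF \<pi> \<gamma> x])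
    also have "\<dots> = ennreal (g x)"
      unfolding g_def using dual_set_integrable[OF Q GLp[OF x]] nonneg[OF x transition_in_E[OF xD]]
      by (intro nn_integral_eq_integral AE_I2) (auto simp: dual_set_space[OF Q])
    finally show "(\<integral>\<^sup>+y. ennreal (G x y) \<partial>?K x) = ennreal (g x)" .
    show "0 \<le> g x"
      unfolding g_def using nonneg[OF x transition_in_E[OF xD]]
      by (intro integral_nonneg_AE AE_I2) (auto simp: dual_set_space[OF Q])
    show "g x \<le> C * b x"
      unfolding g_def by (rule bound[OF x Q])
  qed
  \<comment> \<open>Measurability of \<open>g\<close> is inherited from the kernel integral, with
    which it agrees on \<open>E\<close>.\<close>
  have "(\<lambda>x. \<integral>\<^sup>+y. ennreal (G x y) \<partial>?K x) \<in> borel_measurable B"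
    by (rule nn_integral_measurable_subprob_algebra2[where N=B]) measurable
  then have "(\<lambda>x. enn2real (\<integral>\<^sup>+y. ennreal (G x y) \<partial>?K x)) \<in> borel_measurable B"
    by measurable
  then have g_meas[measurable]: "g \<in> borel_measurable B"
    by (rule measurable_cong[THEN iffD1, rotated]) (simp add: kernel g_nonneg)
  have in_E: "X k \<in> E" if "X \<in> space ?P" for X k
    using law_in_E[OF \<pi> \<gamma> x that] .
  have eq: "(\<integral>\<^sup>+X. ennreal (G (X n) (X (Suc n))) \<partial>?P) = (\<integral>\<^sup>+X. ennreal (g (X n)) \<partial>?P)"
    using nn_integral_law_of_motion_Suc[OF Ionescu_Tulcea_path_kernel[OF \<pi> \<gamma> x] K,
        of "\<lambda>(x, y). ennreal (G x y)"]
    by (auto simp: kernel in_E cong: nn_integral_cong)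
  have "(\<integral>\<^sup>+X. ennreal (g (X n)) \<partial>?P) \<le> (\<integral>\<^sup>+X. ennreal C * ennreal (b (X n)) \<partial>?P)"
    using g_le C b_nonneg in_E
    by (intro nn_integral_mono) (simp add: ennreal_mult[symmetric] ennreal_leI)
  also have "\<dots> = ennreal C * (\<integral>\<^sup>+X. ennreal (b (X n)) \<partial>?P)"
    by (intro nn_integral_cmult) measurable
  also have "\<dots> \<le> ennreal C * ennreal (\<alpha> ^ n * b x)"
    by (intro mult_left_mono moment_bound[OF \<pi> \<gamma> x]) simp
  also have "\<dots> = ennreal (C * (\<alpha> ^ n * b x))"
    using C alpha_nonneg b_nonneg[OF x] by (simp add: ennreal_mult)
  finally have le: "(\<integral>\<^sup>+X. ennreal (g (X n)) \<partial>?P) \<le> ennreal (C * (\<alpha> ^ n * b x))" .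
  then have fin: "(\<integral>\<^sup>+X. ennreal (g (X n)) \<partial>?P) < \<infinity>"
    by (rule le_less_trans) simp
  have G_meas: "(\<lambda>X. G (X n) (X (Suc n))) \<in> borel_measurable ?P"
    by measurable
  show intG: "integrable ?P (\<lambda>X. G (X n) (X (Suc n)))"
    using fin by (intro integrableI_nonneg G_meas AE_I2) (auto simp: eq in_E nonneg)
  show intg: "integrable ?P (\<lambda>X. g (X n))"
    using fin by (intro integrableI_nonneg AE_I2) (auto simp: in_E g_nonneg)
  show eq': "(\<integral>X. G (X n) (X (Suc n)) \<partial>?P) = (\<integral>X. g (X n) \<partial>?P)"
    using G_meas by (subst (1 2) integral_eq_nn_integral) (auto simp: eq in_E g_nonneg nonneg)
  have "ennreal (\<integral>X. g (X n) \<partial>?P) = (\<integral>\<^sup>+X. ennreal (g (X n)) \<partial>?P)"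
    using intg by (intro nn_integral_eq_integral[symmetric] AE_I2) (auto simp: in_E g_nonneg)
  with le have "ennreal (\<integral>X. g (X n) \<partial>?P) \<le> ennreal (C * (\<alpha> ^ n * b x))"
    by simp
  then show "(\<integral>X. G (X n) (X (Suc n)) \<partial>?P) \<le> C * (\<alpha> ^ n * b x)"
    using C alpha_nonneg b_nonneg[OF x] by (subst (asm) ennreal_le_iff) (auto simp: eq')
qed

text \<open>The nonnegative case is applied to the positive part, the negative part and the absolute
  value; the bound on the absolute value controls both parts.\<close>

lemma expectation_Suc:
  fixes G :: "'e \<Rightarrow> 'e \<Rightarrow> real"
  assumes \<pi>: "\<pi> \<in> markov_policies E A D" and \<gamma>: "\<gamma> \<in> \<Gamma>" and x: "x \<in> E"
    and G[measurable]: "(\<lambda>(x, y). G x y) \<in> borel_measurable (B \<Otimes>\<^sub>M B)"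
    and GLp: "\<And>x. x \<in> E \<Longrightarrow> (\<lambda>\<omega>. G x (T x (\<pi> n x) (Z \<omega>))) \<in> Lp_space M (ereal p)"
    and bound: "\<And>x Q. x \<in> E \<Longrightarrow> Q \<in> \<Q> \<Longrightarrow> (\<integral>\<omega>. \<bar>G x (T x (\<pi> n x) (Z \<omega>))\<bar> \<partial>Q) \<le> C * b x"
    and C: "0 \<le> C"
  defines "g \<equiv> \<lambda>x. \<integral>\<omega>. G x (T x (\<pi> n x) (Z \<omega>)) \<partial>\<gamma> n (x, \<pi> n x)"
  shows "integrable (law \<pi> \<gamma> x) (\<lambda>X. G (X n) (X (Suc n)))"
    and "integrable (law \<pi> \<gamma> x) (\<lambda>X. g (X n))"
    and "(\<integral>X. G (X n) (X (Suc n)) \<partial>law \<pi> \<gamma> x) = (\<integral>X. g (X n) \<partial>law \<pi> \<gamma> x)"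
    and "(\<integral>X. \<bar>G (X n) (X (Suc n))\<bar> \<partial>law \<pi> \<gamma> x) \<le> C * (\<alpha> ^ n * b x)"
proof -
  let ?P = "law \<pi> \<gamma> x"
  define Gp where "Gp x y = max 0 (G x y)" for x y
  define Gm where "Gm x y = max 0 (- G x y)" for x y
  let ?t = "\<lambda>x \<omega>. T x (\<pi> n x) (Z \<omega>)"
  have [measurable]: "(\<lambda>(x, y). Gp x y) \<in> borel_measurable (B \<Otimes>\<^sub>M B)"
      "(\<lambda>(x, y). Gm x y) \<in> borel_measurable (B \<Otimes>\<^sub>M B)"
    unfolding Gp_def Gm_def case_prod_beta' using G by (auto simp: case_prod_beta')
  have parts: "(\<lambda>\<omega>. Gp x (?t x \<omega>)) \<in> Lp_space M (ereal p)"
      "(\<lambda>\<omega>. Gm x (?t x \<omega>)) \<in> Lp_space M (ereal p)" if "x \<in> E" for x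
    using Lp_space_measurable[OF GLp[OF that]]
    by (auto intro!: Lp_space_dominated[OF GLp[OF that] p_nonneg] simp: Gp_def Gm_def)
  have part_bound: "(\<integral>\<omega>. Gp x (?t x \<omega>) \<partial>Q) \<le> C * b x" "(\<integral>\<omega>. Gm x (?t x \<omega>) \<partial>Q) \<le> C * b x"
    if "x \<in> E" "Q \<in> \<Q>" for x Q
  proof -
    have "(\<integral>\<omega>. Gp x (?t x \<omega>) \<partial>Q) \<le> (\<integral>\<omega>. \<bar>G x (?t x \<omega>)\<bar> \<partial>Q)"
         "(\<integral>\<omega>. Gm x (?t x \<omega>) \<partial>Q) \<le> (\<integral>\<omega>. \<bar>G x (?t x \<omega>)\<bar> \<partial>Q)"
      by (intro integral_mono dual_set_integrable[OF that(2)] parts GLp that Lp_space_abs;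
          simp add: Gp_def Gm_def)+
    then show "(\<integral>\<omega>. Gp x (?t x \<omega>) \<partial>Q) \<le> C * b x" "(\<integral>\<omega>. Gm x (?t x \<omega>) \<partial>Q) \<le> C * b x"
      using bound[OF that] by auto
  qed
  note P = expectation_Suc_nonneg[OF \<pi> \<gamma> x _ _ parts(1) part_bound(1) C]
    and N = expectation_Suc_nonneg[OF \<pi> \<gamma> x _ _ parts(2) part_bound(2) C]
    and S = expectation_Suc_nonneg[OF \<pi> \<gamma> x, of "\<lambda>x y. \<bar>G x y\<bar>" n C, OF _ _ Lp_space_abs[OF GLp] bound C]
  have G_split: "G x y = Gp x y - Gm x y" for x y
    by (simp add: Gp_def Gm_def)
  have Gp_nonneg: "0 \<le> Gp x y" and Gm_nonneg: "0 \<le> Gm x y" for x y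
    by (simp_all add: Gp_def Gm_def)
  have Ip: "integrable ?P (\<lambda>X. Gp (X n) (X (Suc n)))" and Im: "integrable ?P (\<lambda>X. Gm (X n) (X (Suc n)))"
    by (rule P(1) N(1); simp add: Gp_nonneg Gm_nonneg)+
  then show "integrable ?P (\<lambda>X. G (X n) (X (Suc n)))"
    unfolding G_split by (rule Bochner_Integration.integrable_diff)
  define gp where "gp x = (\<integral>\<omega>. Gp x (?t x \<omega>) \<partial>\<gamma> n (x, \<pi> n x))" for x
  define gm where "gm x = (\<integral>\<omega>. Gm x (?t x \<omega>) \<partial>\<gamma> n (x, \<pi> n x))" for x
  have g_split: "g x = gp x - gm x" if "x \<in> E" for x
    unfolding g_def G_split gp_def gm_def
    using parts[OF that] dual_set_integrable[OF nature_in_dual_set[OF \<gamma> policy_in_D[OF \<pi> that]]]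
    by (intro Bochner_Integration.integral_diff) auto
  have in_E: "X k \<in> E" if "X \<in> space ?P" for X k
    using law_in_E[OF \<pi> \<gamma> x that] .
  have ip: "integrable ?P (\<lambda>X. gp (X n))" and im: "integrable ?P (\<lambda>X. gm (X n))"
    unfolding gp_def gm_def by (rule P(2) N(2); simp add: Gp_nonneg Gm_nonneg)+
  have "integrable ?P (\<lambda>X. gp (X n) - gm (X n))"
    using ip im by (rule Bochner_Integration.integrable_diff)
  then show "integrable ?P (\<lambda>X. g (X n))"
    by (rule Bochner_Integration.integrable_cong[THEN iffD2, rotated 2]) (auto simp: g_split in_E)
  have "(\<integral>X. G (X n) (X (Suc n)) \<partial>?P) =
      (\<integral>X. Gp (X n) (X (Suc n)) \<partial>?P) - (\<integral>X. Gm (X n) (X (Suc n)) \<partial>?P)"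
    unfolding G_split using Ip Im by (rule Bochner_Integration.integral_diff)
  also have "\<dots> = (\<integral>X. gp (X n) \<partial>?P) - (\<integral>X. gm (X n) \<partial>?P)"
    unfolding gp_def gm_def
    by (subst P(3), simp_all add: Gp_nonneg) (subst N(3), simp_all add: Gm_nonneg)
  also have "\<dots> = (\<integral>X. g (X n) \<partial>?P)"
    by (subst Bochner_Integration.integral_diff[OF ip im, symmetric])
      (auto intro!: Bochner_Integration.integral_cong simp: g_split in_E)
  finally show "(\<integral>X. G (X n) (X (Suc n)) \<partial>?P) = (\<integral>X. g (X n) \<partial>?P)" .
  show "(\<integral>X. \<bar>G (X n) (X (Suc n))\<bar> \<partial>?P) \<le> C * (\<alpha> ^ n * b x)"
    by (rule S(4)) auto
qed

section \<open>Values-to-go and their weighted bounds\<close>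

definition step_cost :: "('e \<Rightarrow> real) \<Rightarrow> 'e \<Rightarrow> 'a \<Rightarrow> 'o \<Rightarrow> real" where
  "step_cost w x a \<omega> = c x a (T x a (Z \<omega>)) + \<beta> * w (T x a (Z \<omega>))"

text \<open>Under \<open>Q\<close> the cost contributes at most \<open>b x\<close>, the continuation
  at most \<beta> C times \<alpha> \<open>b x\<close>; this produces the new constant 1 + \<alpha>
  \<beta> C.\<close>

lemma step_cost_Lp:
  assumes xa: "(x, a) \<in> D" and [measurable]: "w \<in> borel_measurable B"
    and w: "\<forall>y\<in>E. \<bar>w y\<bar> \<le> C * b y"
  shows "step_cost w x a \<in> Lp_space M (ereal p)"
    and "Q \<in> \<Q> \<Longrightarrow> 0 \<le> C \<Longrightarrow> (\<integral>\<omega>. \<bar>step_cost w x a \<omega>\<bar> \<partial>Q) \<le> (1 + \<alpha> * \<beta> * C) * b x"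
proof -
  note transition_noise_measurable[OF xa, measurable]
  have le: "\<bar>w (T x a (Z \<omega>))\<bar> \<le> \<bar>C * b (T x a (Z \<omega>))\<bar>" if "\<omega> \<in> space M" for \<omega>
    using w transition_in_E[OF xa that] abs_ge_self order_trans by blast
  have w_Lp: "(\<lambda>\<omega>. w (T x a (Z \<omega>))) \<in> Lp_space M (ereal p)"
    using le by (intro Lp_space_dominated[OF Lp_space_cmult[OF b_Lp[OF xa]]] p_nonneg) measurable
  show Lp: "step_cost w x a \<in> Lp_space M (ereal p)"
    unfolding step_cost_def[abs_def]
    by (intro Lp_space_add Lp_space_cmult cost_Lp xa w_Lp p_nonneg)
  assume Q: "Q \<in> \<Q>" and C: "0 \<le> C"
  note int = dual_set_integrable[OF Q]
  have "(\<integral>\<omega>. \<bar>step_cost w x a \<omega>\<bar> \<partial>Q) \<le>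
      (\<integral>\<omega>. \<bar>c x a (T x a (Z \<omega>))\<bar> + (\<beta> * C) * b (T x a (Z \<omega>)) \<partial>Q)"
  proof (intro integral_mono int Lp_space_abs Lp_space_add Lp_space_cmult Lp cost_Lp b_Lp xa p_nonneg)
    fix \<omega> assume "\<omega> \<in> space Q"
    then have "\<bar>w (T x a (Z \<omega>))\<bar> \<le> C * b (T x a (Z \<omega>))"
      using w transition_in_E[OF xa] by (simp add: dual_set_space[OF Q])
    then have "\<bar>\<beta> * w (T x a (Z \<omega>))\<bar> \<le> \<beta> * (C * b (T x a (Z \<omega>)))"
      using beta_pos by (simp add: abs_mult)
    then show "\<bar>step_cost w x a \<omega>\<bar> \<le> \<bar>c x a (T x a (Z \<omega>))\<bar> + (\<beta> * C) * b (T x a (Z \<omega>))"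
      unfolding step_cost_def by (simp add: mult.assoc)
  qed
  also have "\<dots> = (\<integral>\<omega>. \<bar>c x a (T x a (Z \<omega>))\<bar> \<partial>Q) + (\<beta> * C) * (\<integral>\<omega>. b (T x a (Z \<omega>)) \<partial>Q)"
    by (subst Bochner_Integration.integral_add)
      (auto intro!: int Lp_space_abs Lp_space_cmult cost_Lp b_Lp xa p_nonneg)
  also have "\<dots> \<le> b x + (\<beta> * C) * (\<alpha> * b x)"
    using beta_pos C by (intro add_mono mult_left_mono cost_bound b_bound xa Q) auto
  finally show "(\<integral>\<omega>. \<bar>step_cost w x a \<omega>\<bar> \<partial>Q) \<le> (1 + \<alpha> * \<beta> * C) * b x"
    by (simp add: algebra_simps)
qed

text \<open>The sum of the geometric series with ratio \<alpha> \<beta>, and so the fixed point of C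
  \<mapsto> 1 + \<alpha> \<beta> C. One constant therefore works for all horizons and all
  times.\<close>

definition value_bound :: real where
  "value_bound = 1 / (1 - \<alpha> * \<beta>)"

lemma value_bound_nonneg: "0 \<le> value_bound"
  using contraction by (simp add: value_bound_def)

lemma value_bound_eq: "1 + \<alpha> * \<beta> * value_bound = value_bound"
  using contraction by (simp add: value_bound_def field_simps)

text \<open>The value-to-go at time \<open>n\<close> in a problem with horizon \<open>N\<close>. As
  a finite value of the shifted policy, itself Markov, it is covered by the assumed measurability of
  policy values.\<close>

definition tail_value :: "(nat \<Rightarrow> 'e \<Rightarrow> 'a) \<Rightarrow> nat \<Rightarrow> nat \<Rightarrow> 'e \<Rightarrow> ereal" where
  "tail_value \<pi> N n = finite_policy_value \<rho> c T Z \<beta> (N - n) (\<lambda>k. \<pi> (n + k))"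

lemma tail_value_0: "tail_value \<pi> N 0 = finite_policy_value \<rho> c T Z \<beta> N \<pi>"
  by (simp add: tail_value_def)

lemma tail_value_end: "tail_value \<pi> N N = (\<lambda>_. 0)"
  by (simp add: tail_value_def finite_policy_value_def)

lemma finite_policy_value_Suc:
  "finite_policy_value \<rho> c T Z \<beta> (Suc m) \<pi> =
     policy_operator \<rho> c T Z \<beta> (\<pi> 0) (finite_policy_value \<rho> c T Z \<beta> m (\<lambda>k. \<pi> (Suc k)))"
proof -
  have "[0..<Suc m] = 0 # map Suc [0..<m]"
    by (simp only: map_Suc_upt upt_conv_Cons[OF zero_less_Suc])
  then show ?thesis
    by (simp only: finite_policy_value_def foldr.simps foldr_map comp_def)
qed

lemma tail_value_step:
  assumes "n < N"
  shows "tail_value \<pi> N n x = \<rho> (step_cost (\<lambda>y. real_of_ereal (tail_value \<pi> N (Suc n) y)) x (\<pi> n x))"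
proof -
  have "N - n = Suc (N - Suc n)"
    using assms by simp
  then show ?thesis
    by (simp add: tail_value_def finite_policy_value_Suc policy_operator_def step_cost_def[abs_def])
qed

definition real_tail_value :: "(nat \<Rightarrow> 'e \<Rightarrow> 'a) \<Rightarrow> nat \<Rightarrow> nat \<Rightarrow> 'e \<Rightarrow> real" where
  "real_tail_value \<pi> N n x = real_of_ereal (tail_value \<pi> N n x)"

lemma real_tail_value_measurable [measurable]:
  assumes "\<pi> \<in> markov_policies E A D"
  shows "real_tail_value \<pi> N n \<in> borel_measurable B"
  unfolding real_tail_value_def[abs_def] tail_value_def
  using finite_values_meas[OF policy_shift[OF assms]] by measurable

text \<open>Backward induction in \<open>n\<close>. The operator reads its argument through
  \<open>real_of_ereal\<close>, which would turn infinite values into 0; finiteness on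
  \<open>E\<close> shows that this does not happen. Since \<open>\<rho>\<close> is attained as an
  integral, the bound on the integral of the absolute value bounds it from both sides.\<close>

lemma tail_value_bound:
  assumes \<pi>: "\<pi> \<in> markov_policies E A D" and "n \<le> N" and "x \<in> E"
  shows "tail_value \<pi> N n x = ereal (real_tail_value \<pi> N n x) \<and>
    \<bar>real_tail_value \<pi> N n x\<bar> \<le> value_bound * b x"
  using assms(2,3)
proof (induction n arbitrary: x rule: inc_induct)
  case base
  then show ?case
    using value_bound_nonneg b_nonneg by (simp add: real_tail_value_def tail_value_end)
next
  case (step n)
  let ?w = "real_tail_value \<pi> N (Suc n)"
  let ?S = "step_cost ?w x (\<pi> n x)"
  note xD = policy_in_D[OF \<pi> step.prems, of n]
  have w: "\<forall>y\<in>E. \<bar>?w y\<bar> \<le> value_bound * b y"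
    using step.IH by simp
  note Lp = step_cost_Lp[OF xD real_tail_value_measurable[OF \<pi>] w]
  obtain Q where Q: "Q \<in> \<Q>" "\<rho> ?S = ereal (\<integral>\<omega>. ?S \<omega> \<partial>Q)"
    using rho_attained[OF Lp(1)] by auto
  have "tail_value \<pi> N n x = \<rho> ?S"
    using tail_value_step[OF step.hyps(2)] by (simp add: real_tail_value_def[abs_def])
  moreover have "\<bar>\<integral>\<omega>. ?S \<omega> \<partial>Q\<bar> \<le> value_bound * b x"
  proof (rule order_trans)
    show "\<bar>\<integral>\<omega>. ?S \<omega> \<partial>Q\<bar> \<le> (\<integral>\<omega>. \<bar>?S \<omega>\<bar> \<partial>Q)"
      by (rule integral_abs_bound)
    show "(\<integral>\<omega>. \<bar>?S \<omega>\<bar> \<partial>Q) \<le> value_bound * b x"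
      using Lp(2)[OF Q(1) value_bound_nonneg] by (simp add: value_bound_eq)
  qed
  ultimately show ?case
    by (simp add: Q(2) real_tail_value_def)
qed

lemma real_tail_value_step:
  assumes "\<pi> \<in> markov_policies E A D" and "n < N" and "x \<in> E"
  shows "ereal (real_tail_value \<pi> N n x) =
    \<rho> (step_cost (real_tail_value \<pi> N (Suc n)) x (\<pi> n x))"
proof -
  have "(\<lambda>y. real_of_ereal (tail_value \<pi> N (Suc n) y)) = real_tail_value \<pi> N (Suc n)"
    by (simp add: fun_eq_iff real_tail_value_def)
  then have "tail_value \<pi> N n x = \<rho> (step_cost (real_tail_value \<pi> N (Suc n)) x (\<pi> n x))"
    using tail_value_step[OF assms(2), of \<pi> x] by simp
  moreover have "tail_value \<pi> N n x = ereal (real_tail_value \<pi> N n x)"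
    using tail_value_bound[OF assms(1) less_imp_le[OF assms(2)] assms(3)] by blast
  ultimately show ?thesis by simp
qed

section \<open>Measurable almost optimal choices of nature\<close>

text \<open>The norming sequence does not depend on the pair (x, a), so the selection is a
  measurable choice of an index. The exact maximiser may lie outside the sequence, hence the
  \<epsilon>.\<close>

lemma measurable_almost_optimal_nature:
  assumes w[measurable]: "w \<in> borel_measurable B" and wb: "\<forall>y\<in>E. \<bar>w y\<bar> \<le> C * b y"
    and "0 < \<epsilon>"
  shows "\<exists>g \<in> restrict_space borel D \<rightarrow>\<^sub>M dual_borel M (ereal p) q \<Q>.
    \<forall>(x, a)\<in>D. \<rho> (step_cost w x a) < ereal ((\<integral>\<omega>. step_cost w x a \<omega> \<partial>g (x, a)) + \<epsilon>)"
proof -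
  obtain Qs :: "nat \<Rightarrow> 'o measure" where Qs: "range Qs \<subseteq> \<Q>"
    and norming: "\<And>f \<epsilon>. f \<in> borel_measurable MZ \<Longrightarrow> (\<lambda>\<omega>. f (Z \<omega>)) \<in> Lp_space M (ereal p) \<Longrightarrow>
        0 < \<epsilon> \<Longrightarrow> \<exists>k. \<rho> (\<lambda>\<omega>. f (Z \<omega>)) < ereal ((\<integral>\<omega>. f (Z \<omega>) \<partial>Qs k) + \<epsilon>)"
    using countable_norming_sequence[OF Z_meas Z_separable] by blast
  have Qs': "Qs k \<in> \<Q>" for k
    using Qs by auto
  let ?h = "\<lambda>k s. \<integral>\<omega>. step_cost w (fst s) (snd s) \<omega> \<partial>Qs k"
  let ?D = "restrict_space borel D"
  let ?t = "\<lambda>r. T (fst (fst r)) (snd (fst r)) (Z (snd r))"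
  have t: "?t \<in> ?D \<Otimes>\<^sub>M M \<rightarrow>\<^sub>M B"
    using transition_measurable by (simp add: case_prod_beta)
  have "(\<lambda>r. c (fst (fst r)) (snd (fst r)) (?t r)) \<in> borel_measurable (?D \<Otimes>\<^sub>M M)"
    using measurable_compose[OF measurable_Pair[OF measurable_fst t] c_meas]
    by (simp add: case_prod_beta)
  moreover have "(\<lambda>r. w (?t r)) \<in> borel_measurable (?D \<Otimes>\<^sub>M M)"
    using t w by (rule measurable_compose)
  \<comment> \<open>Joint measurability in the pair and the outcome makes the integral under each
    fixed \<open>Qs k\<close> a measurable function of the pair.\<close>
  ultimately have step_meas: "(\<lambda>(s, \<omega>). step_cost w (fst s) (snd s) \<omega>) \<in> borel_measurable (?D \<Otimes>\<^sub>M M)"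
    unfolding step_cost_def case_prod_beta by measurable
  have h[measurable]: "?h k \<in> borel_measurable (restrict_space borel D)" for k
  proof -
    interpret Qk: prob_space "Qs k" by (rule dual_setD[OF Qs'])
    have "(\<lambda>(s, \<omega>). step_cost w (fst s) (snd s) \<omega>) \<in> borel_measurable (restrict_space borel D \<Otimes>\<^sub>M Qs k)"
      using step_meas by (simp add: measurable_cong_sets[OF sets_pair_measure_cong[OF refl dual_setD(2)[OF Qs']] refl])
    then show ?thesis
      by (rule Qk.borel_measurable_lebesgue_integral)
  qed
  have near: "\<exists>k. \<rho> (step_cost w x a) < ereal ((\<integral>\<omega>. step_cost w x a \<omega> \<partial>Qs k) + e)"
    if xa: "(x, a) \<in> D" and "0 < e" for x a e
  proof -
    note transition_noise_measurable[OF xa, measurable] cost_noise_measurable[OF xa, measurable]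
    have "(\<lambda>z. c x a (T x a z) + \<beta> * w (T x a z)) \<in> borel_measurable MZ"
      by measurable
    from norming[OF this _ \<open>0 < e\<close>] show ?thesis
      using step_cost_Lp(1)[OF xa w wb] by (simp add: step_cost_def[abs_def])
  qed
  have sup: "\<rho> (step_cost w x a) = (SUP k. ereal (?h k (x, a)))" if xa: "(x, a) \<in> D" for x a
  proof (rule antisym)
    show "\<rho> (step_cost w x a) \<le> (SUP k. ereal (?h k (x, a)))"
    proof (rule ereal_le_epsilon2)
      fix e :: real assume "0 < e"
      then obtain k where "\<rho> (step_cost w x a) < ereal ((\<integral>\<omega>. step_cost w x a \<omega> \<partial>Qs k) + e)"
        using near[OF xa] by blast
      also have "\<dots> = ereal (?h k (x, a)) + ereal e"
        by simp
      also have "\<dots> \<le> (SUP k. ereal (?h k (x, a))) + ereal e"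
        by (intro add_right_mono SUP_upper) simp
      finally show "\<rho> (step_cost w x a) \<le> (SUP k. ereal (?h k (x, a))) + ereal e"
        by simp
    qed
    show "(SUP k. ereal (?h k (x, a))) \<le> \<rho> (step_cost w x a)"
      by (rule SUP_least) (simp add: integral_le_rho[OF Qs' step_cost_Lp(1)[OF xa w wb]])
  qed
  \<comment> \<open>\<open>H\<close> is the risk written as a countable supremum; this form displays
    its measurability on \<open>D\<close>.\<close>
  define H where "H s = (SUP k. ereal (?h k s))" for s
  have [measurable]: "H \<in> borel_measurable (restrict_space borel D)"
    unfolding H_def by measurable
  \<comment> \<open>The least index is measurable because each event {k is \<epsilon>-optimal} is;
    the discrete range makes the composition with \<open>Qs\<close> measurable for any
    \<sigma>-algebra on \<open>\<Q>\<close>.\<close>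
  define K where "K s = (LEAST k. H s < ereal (?h k s + \<epsilon>))" for s
  have K: "K \<in> restrict_space borel D \<rightarrow>\<^sub>M count_space UNIV"
    unfolding K_def by measurable
  have "Qs \<in> count_space UNIV \<rightarrow>\<^sub>M dual_borel M (ereal p) q \<Q>"
    using Qs by auto
  then have "(\<lambda>s. Qs (K s)) \<in> restrict_space borel D \<rightarrow>\<^sub>M dual_borel M (ereal p) q \<Q>"
    by (rule measurable_compose[OF K])
  moreover have "\<rho> (step_cost w x a) < ereal ((\<integral>\<omega>. step_cost w x a \<omega> \<partial>Qs (K (x, a))) + \<epsilon>)"
    if xa: "(x, a) \<in> D" for x a
  proof -
    have "\<exists>k. H (x, a) < ereal (?h k (x, a) + \<epsilon>)"
      using near[OF xa \<open>0 < \<epsilon>\<close>] sup[OF xa] by (simp add: H_def)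
    then have "H (x, a) < ereal (?h (K (x, a)) (x, a) + \<epsilon>)"
      unfolding K_def by (rule LeastI_ex)
    then show ?thesis
      using sup[OF xa] by (simp add: H_def)
  qed
  ultimately show ?thesis
    by (intro bexI[of _ "\<lambda>s. Qs (K s)"]) auto
qed

section \<open>Expected costs along the path and their telescoping\<close>

lemma distr_law_0:
  assumes \<pi>: "\<pi> \<in> markov_policies E A D" and \<gamma>: "\<gamma> \<in> \<Gamma>" and x: "x \<in> E"
  shows "distr (law \<pi> \<gamma> x) B (\<lambda>X. X 0) = return B x"
proof (rule measure_eqI)
  fix S assume "S \<in> sets (distr (law \<pi> \<gamma> x) B (\<lambda>X. X 0))"
  then have S: "S \<in> sets B" by simp
  have "emeasure (distr (law \<pi> \<gamma> x) B (\<lambda>X. X 0)) S =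
      (\<integral>\<^sup>+y. indicator S y \<partial>distr (law \<pi> \<gamma> x) B (\<lambda>X. X 0))"
    using S by simp
  also have "\<dots> = (\<integral>\<^sup>+X. indicator S (X 0) \<partial>law \<pi> \<gamma> x)"
    using S law_measurable[OF assms] by (intro nn_integral_distr) auto
  also have "\<dots> = indicator S x"
    using S by (intro nn_integral_law_of_motion_0[OF Ionescu_Tulcea_path_kernel[OF assms] x]) auto
  finally show "emeasure (distr (law \<pi> \<gamma> x) B (\<lambda>X. X 0)) S = emeasure (return B x) S"
    using S by simp
qed simp

lemma integral_law_0:
  fixes f :: "'e \<Rightarrow> real"
  assumes "\<pi> \<in> markov_policies E A D" "\<gamma> \<in> \<Gamma>" "x \<in> E" and f: "f \<in> borel_measurable B"
  shows "(\<integral>X. f (X 0) \<partial>law \<pi> \<gamma> x) = f x"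
  using integral_distr[OF law_measurable[OF assms(1-3), of 0] f] assms
  by (simp add: distr_law_0 integral_return)

lemma integrable_moment:
  assumes "\<pi> \<in> markov_policies E A D" "\<gamma> \<in> \<Gamma>" "x \<in> E"
    and f: "f \<in> borel_measurable B" "\<And>y. y \<in> E \<Longrightarrow> \<bar>f y\<bar> \<le> C * b y"
  shows "integrable (law \<pi> \<gamma> x) (\<lambda>X. f (X n) :: real)"
proof (rule Bochner_Integration.integrable_bound)
  note law_measurable[OF assms(1-3), measurable] f(1)[measurable]
  have "(\<integral>\<^sup>+X. ennreal (b (X n)) \<partial>law \<pi> \<gamma> x) < \<infinity>"
    by (rule le_less_trans[OF moment_bound[OF assms(1-3)]]) simp
  then have "integrable (law \<pi> \<gamma> x) (\<lambda>X. b (X n))"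
    using b_nonneg law_in_E[OF assms(1-3)] by (intro integrableI_nonneg AE_I2) auto
  then show "integrable (law \<pi> \<gamma> x) (\<lambda>X. C * b (X n))"
    by simp
  show "(\<lambda>X. f (X n)) \<in> borel_measurable (law \<pi> \<gamma> x)"
    by measurable
  show "AE X in law \<pi> \<gamma> x. norm (f (X n)) \<le> norm (C * b (X n))"
    using f(2) law_in_E[OF assms(1-3)] by (intro AE_I2) (fastforce intro: order_trans[OF _ abs_ge_self])
qed

definition expected_cost ::
  "(nat \<Rightarrow> 'e \<Rightarrow> 'a) \<Rightarrow> (nat \<Rightarrow> 'e \<times> 'a \<Rightarrow> 'o measure) \<Rightarrow> 'e \<Rightarrow> nat \<Rightarrow> real" where
  "expected_cost \<pi> \<gamma> x n = (\<integral>X. c (X n) (\<pi> n (X n)) (X (Suc n)) \<partial>law \<pi> \<gamma> x)"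

lemma
  assumes \<pi>: "\<pi> \<in> markov_policies E A D" and \<gamma>: "\<gamma> \<in> \<Gamma>" and x: "x \<in> E"
  shows integrable_cost: "integrable (law \<pi> \<gamma> x) (\<lambda>X. c (X n) (\<pi> n (X n)) (X (Suc n)))"
    and expected_abs_cost_le:
      "(\<integral>X. \<bar>c (X n) (\<pi> n (X n)) (X (Suc n))\<bar> \<partial>law \<pi> \<gamma> x) \<le> \<alpha> ^ n * b x"
proof -
  have *: "(\<lambda>\<omega>. c x (\<pi> n x) (T x (\<pi> n x) (Z \<omega>))) \<in> Lp_space M (ereal p)"
      "Q \<in> \<Q> \<Longrightarrow> (\<integral>\<omega>. \<bar>c x (\<pi> n x) (T x (\<pi> n x) (Z \<omega>))\<bar> \<partial>Q) \<le> 1 * b x" if "x \<in> E" for x Q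
    using cost_Lp cost_bound policy_in_D[OF \<pi> that] by auto
  note exp = expectation_Suc[OF \<pi> \<gamma> x, where G="\<lambda>x y. c x (\<pi> n x) y" and n=n and C=1,
      OF policy_cost_measurable[OF \<pi>] *]
  show "integrable (law \<pi> \<gamma> x) (\<lambda>X. c (X n) (\<pi> n (X n)) (X (Suc n)))"
    by (rule exp(1)) auto
  have "(\<integral>X. \<bar>c (X n) (\<pi> n (X n)) (X (Suc n))\<bar> \<partial>law \<pi> \<gamma> x) \<le> 1 * (\<alpha> ^ n * b x)"
    by (rule exp(4)) auto
  then show "(\<integral>X. \<bar>c (X n) (\<pi> n (X n)) (X (Suc n))\<bar> \<partial>law \<pi> \<gamma> x) \<le> \<alpha> ^ n * b x"
    by simp
qed

lemma expected_finite_discounted_cost: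
  assumes "\<pi> \<in> markov_policies E A D" "\<gamma> \<in> \<Gamma>" "x \<in> E"
  shows "(\<integral>X. discounted_cost c \<beta> (enat N) \<pi> X \<partial>law \<pi> \<gamma> x) = (\<Sum>k<N. \<beta> ^ k * expected_cost \<pi> \<gamma> x k)"
  unfolding discounted_cost_def expected_cost_def
  using integrable_cost[OF assms] by simp

text \<open>Conditioning on X_n turns the current cost plus the discounted continuation into
  \<open>step_cost\<close> integrated against nature's choice. This integral is what the dual
  representation compares with the value-to-go.\<close>

lemma expectation_step_cost:
  fixes w :: "'e \<Rightarrow> real" and n :: nat
  assumes \<pi>: "\<pi> \<in> markov_policies E A D" and \<gamma>: "\<gamma> \<in> \<Gamma>" and x: "x \<in> E"
    and w[measurable]: "w \<in> borel_measurable B" and wb: "\<forall>y\<in>E. \<bar>w y\<bar> \<le> C * b y" and C: "0 \<le> C"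
  defines "g \<equiv> \<lambda>y. \<integral>\<omega>. step_cost w y (\<pi> n y) \<omega> \<partial>\<gamma> n (y, \<pi> n y)"
  shows "integrable (law \<pi> \<gamma> x) (\<lambda>X. g (X n))"
    and "expected_cost \<pi> \<gamma> x n + \<beta> * (\<integral>X. w (X (Suc n)) \<partial>law \<pi> \<gamma> x) = (\<integral>X. g (X n) \<partial>law \<pi> \<gamma> x)"
proof -
  let ?G = "\<lambda>x y. c x (\<pi> n x) y + \<beta> * w y"
  have G: "(\<lambda>(x, y). ?G x y) \<in> borel_measurable (B \<Otimes>\<^sub>M B)"
  proof -
    have "(\<lambda>r. c (fst r) (\<pi> n (fst r)) (snd r)) \<in> borel_measurable (B \<Otimes>\<^sub>M B)"
      using policy_cost_measurable[OF \<pi>, of n] by (simp add: case_prod_beta')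
    then show ?thesis
      unfolding case_prod_beta' by measurable
  qed
  have *: "(\<lambda>\<omega>. ?G y (T y (\<pi> n y) (Z \<omega>))) \<in> Lp_space M (ereal p)"
      "Q \<in> \<Q> \<Longrightarrow> (\<integral>\<omega>. \<bar>?G y (T y (\<pi> n y) (Z \<omega>))\<bar> \<partial>Q) \<le> (1 + \<alpha> * \<beta> * C) * b y" if "y \<in> E" for y Q
    using step_cost_Lp[OF policy_in_D[OF \<pi> that, of n] w wb] C
    by (auto simp: step_cost_def[abs_def])
  have C': "0 \<le> 1 + \<alpha> * \<beta> * C"
    using alpha_nonneg beta_pos C by simp
  note exp = expectation_Suc[OF \<pi> \<gamma> x, where G="?G" and n=n and C="1 + \<alpha> * \<beta> * C", OF G *]
  show "integrable (law \<pi> \<gamma> x) (\<lambda>X. g (X n))"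
    unfolding g_def step_cost_def by (rule exp(2)) (use C' in auto)
  have wint: "integrable (law \<pi> \<gamma> x) (\<lambda>X. w (X (Suc n)))"
    using wb by (intro integrable_moment[OF \<pi> \<gamma> x w]) auto
  have "(\<integral>X. ?G (X n) (X (Suc n)) \<partial>law \<pi> \<gamma> x) = (\<integral>X. g (X n) \<partial>law \<pi> \<gamma> x)"
    unfolding g_def step_cost_def by (rule exp(3)) (use C' in auto)
  then show "expected_cost \<pi> \<gamma> x n + \<beta> * (\<integral>X. w (X (Suc n)) \<partial>law \<pi> \<gamma> x) = (\<integral>X. g (X n) \<partial>law \<pi> \<gamma> x)"
    using integrable_cost[OF \<pi> \<gamma> x] wint by (simp add: expected_cost_def)
qed

lemma real_tail_value_bound:
  assumes "\<pi> \<in> markov_policies E A D" "n \<le> N"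
  shows "\<forall>y\<in>E. \<bar>real_tail_value \<pi> N n y\<bar> \<le> value_bound * b y"
  using tail_value_bound[OF assms] by blast

text \<open>With \<open>U n\<close> the expected value-to-go at time \<open>n\<close>, the costs
  discounted up to \<open>m\<close> plus \<beta>^m U m do not increase in \<open>m\<close>. At 0
  this quantity is the policy value, at \<open>N\<close> it is the total expected cost, because the
  terminal value vanishes.\<close>

lemma expected_cost_le_value:
  assumes \<pi>: "\<pi> \<in> markov_policies E A D" and \<gamma>: "\<gamma> \<in> \<Gamma>" and x: "x \<in> E"
  shows "(\<Sum>k<N. \<beta> ^ k * expected_cost \<pi> \<gamma> x k) \<le> real_tail_value \<pi> N 0 x"
proof -
  let ?u = "real_tail_value \<pi> N"
  define U where "U n = (\<integral>X. ?u n (X n) \<partial>law \<pi> \<gamma> x)" for n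
  have step: "expected_cost \<pi> \<gamma> x n + \<beta> * U (Suc n) \<le> U n" if n: "n < N" for n
  proof -
    note u = real_tail_value_measurable[OF \<pi>] real_tail_value_bound[OF \<pi>, of "Suc n" N, OF Suc_leI[OF n]]
    note exp = expectation_step_cost[OF \<pi> \<gamma> x u value_bound_nonneg, of n]
    have "expected_cost \<pi> \<gamma> x n + \<beta> * U (Suc n) =
        (\<integral>X. (\<integral>\<omega>. step_cost (?u (Suc n)) (X n) (\<pi> n (X n)) \<omega> \<partial>\<gamma> n (X n, \<pi> n (X n))) \<partial>law \<pi> \<gamma> x)"
      unfolding U_def by (rule exp(2))
    also have "\<dots> \<le> U n"
      unfolding U_def
    proof (rule integral_mono[OF exp(1)])
      show "integrable (law \<pi> \<gamma> x) (\<lambda>X. ?u n (X n))"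
        using real_tail_value_bound[OF \<pi>, of n N] n
        by (intro integrable_moment[OF \<pi> \<gamma> x] real_tail_value_measurable[OF \<pi>]) auto
      fix X assume "X \<in> space (law \<pi> \<gamma> x)"
      then have X: "X n \<in> E"
        by (rule law_in_E[OF \<pi> \<gamma> x])
      note XD = policy_in_D[OF \<pi> X, of n]
      show "(\<integral>\<omega>. step_cost (?u (Suc n)) (X n) (\<pi> n (X n)) \<omega> \<partial>\<gamma> n (X n, \<pi> n (X n))) \<le> ?u n (X n)"
        using integral_le_rho[OF nature_in_dual_set[OF \<gamma> XD, of n] step_cost_Lp(1)[OF XD u]]
        by (simp add: real_tail_value_step[OF \<pi> n X, symmetric])
    qed
    finally show ?thesis .
  qed
  have "(\<Sum>k<m. \<beta> ^ k * expected_cost \<pi> \<gamma> x k) + \<beta> ^ m * U m \<le> U 0" if "m \<le> N" for m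
    using that
  proof (induction m)
    case (Suc m)
    have "\<beta> ^ m * (expected_cost \<pi> \<gamma> x m + \<beta> * U (Suc m)) \<le> \<beta> ^ m * U m"
      using Suc.prems beta_pos by (intro mult_left_mono step) auto
    then show ?case
      using Suc by (simp add: algebra_simps)
  qed simp
  from this[of N] show ?thesis
    using integral_law_0[OF \<pi> \<gamma> x real_tail_value_measurable[OF \<pi>], of N 0]
    by (simp add: U_def) (simp add: real_tail_value_def tail_value_end)
qed

lemma almost_optimal_nature:
  assumes \<pi>: "\<pi> \<in> markov_policies E A D" and x: "x \<in> E" and "0 < \<epsilon>"
  shows "\<exists>\<gamma>\<in>\<Gamma>. real_tail_value \<pi> N 0 x \<le> (\<Sum>k<N. \<beta> ^ k * expected_cost \<pi> \<gamma> x k) + \<epsilon>"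
proof -
  let ?u = "real_tail_value \<pi> N"
  \<comment> \<open>An error \<delta> at step \<open>k\<close> enters with weight \<beta>^k, so the
    total is at most \<epsilon>. The summand 1 keeps the denominator positive for N = 0.\<close>
  define \<delta> where "\<delta> = \<epsilon> / ((\<Sum>k<N. \<beta> ^ k) + 1)"
  have S: "0 \<le> (\<Sum>k<N. \<beta> ^ k)"
    using beta_pos by (intro sum_nonneg) auto
  have "0 < \<delta>"
    unfolding \<delta>_def using S \<open>0 < \<epsilon>\<close> by (intro divide_pos_pos) auto
  have "\<delta> * (\<Sum>k<N. \<beta> ^ k) \<le> \<epsilon>"
    unfolding \<delta>_def using S \<open>0 < \<epsilon>\<close> by (simp add: field_simps)
  \<comment> \<open>Optimality is demanded before the horizon only, but membership in
    \<open>\<Gamma>\<close> still requires a measurable map at every later time; a selection for the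
    zero continuation supplies it.\<close>
  define good where "good n g \<longleftrightarrow> (n < N \<longrightarrow> (\<forall>(x, a)\<in>D. \<rho> (step_cost (?u (Suc n)) x a) <
      ereal ((\<integral>\<omega>. step_cost (?u (Suc n)) x a \<omega> \<partial>g (x, a)) + \<delta>)))" for n g
  have "\<exists>g \<in> restrict_space borel D \<rightarrow>\<^sub>M dual_borel M (ereal p) q \<Q>. good n g" for n
  proof (cases "n < N")
    case True
    then show ?thesis
      using measurable_almost_optimal_nature[OF real_tail_value_measurable[OF \<pi>]
          real_tail_value_bound[OF \<pi>, of "Suc n" N] \<open>0 < \<delta>\<close>]
      unfolding good_def by auto
  next
    case False
    then show ?thesis
      using measurable_almost_optimal_nature[of "\<lambda>_. 0" 0, OF _ _ \<open>0 < \<delta>\<close>]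
      unfolding good_def by auto
  qed
  then have "\<forall>n. \<exists>g. g \<in> restrict_space borel D \<rightarrow>\<^sub>M dual_borel M (ereal p) q \<Q> \<and> good n g"
    by blast
  from choice[OF this] obtain \<gamma>
    where \<gamma>_meas: "\<And>n. \<gamma> n \<in> restrict_space borel D \<rightarrow>\<^sub>M dual_borel M (ereal p) q \<Q>"
    and "\<And>n. good n (\<gamma> n)"
    by blast
  then have \<gamma>_opt: "\<rho> (step_cost (?u (Suc n)) x a) <
      ereal ((\<integral>\<omega>. step_cost (?u (Suc n)) x a \<omega> \<partial>\<gamma> n (x, a)) + \<delta>)"
    if "n < N" "(x, a) \<in> D" for n x a
    using that unfolding good_def by blast
  have \<gamma>: "\<gamma> \<in> \<Gamma>"
    using \<gamma>_meas by (simp add: nature_policies_def)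
  interpret P: prob_space "law \<pi> \<gamma> x"
    by (rule prob_space_law[OF \<pi> \<gamma> x])
  define U where "U n = (\<integral>X. ?u n (X n) \<partial>law \<pi> \<gamma> x)" for n
  have step: "U n \<le> expected_cost \<pi> \<gamma> x n + \<beta> * U (Suc n) + \<delta>" if n: "n < N" for n
  proof -
    note u = real_tail_value_measurable[OF \<pi>] real_tail_value_bound[OF \<pi>, of "Suc n" N, OF Suc_leI[OF n]]
    note exp = expectation_step_cost[OF \<pi> \<gamma> x u value_bound_nonneg, of n]
    let ?g = "\<lambda>X. \<integral>\<omega>. step_cost (?u (Suc n)) (X n) (\<pi> n (X n)) \<omega> \<partial>\<gamma> n (X n, \<pi> n (X n))"
    have "U n \<le> (\<integral>X. ?g X + \<delta> \<partial>law \<pi> \<gamma> x)"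
      unfolding U_def
    proof (rule integral_mono)
      show "integrable (law \<pi> \<gamma> x) (\<lambda>X. ?g X + \<delta>)"
        using exp(1) by simp
      show "integrable (law \<pi> \<gamma> x) (\<lambda>X. ?u n (X n))"
        using real_tail_value_bound[OF \<pi>, of n N] n
        by (intro integrable_moment[OF \<pi> \<gamma> x] real_tail_value_measurable[OF \<pi>]) auto
      fix X assume "X \<in> space (law \<pi> \<gamma> x)"
      then have X: "X n \<in> E"
        by (rule law_in_E[OF \<pi> \<gamma> x])
      show "?u n (X n) \<le> ?g X + \<delta>"
        using \<gamma>_opt[OF n policy_in_D[OF \<pi> X, of n]]
        by (simp add: real_tail_value_step[OF \<pi> n X, symmetric])
    qed
    also have "\<dots> = expected_cost \<pi> \<gamma> x n + \<beta> * U (Suc n) + \<delta>"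
      unfolding U_def exp(2) using exp(1) by (simp add: P.prob_space)
    finally show ?thesis .
  qed
  have "U 0 \<le> (\<Sum>k<m. \<beta> ^ k * expected_cost \<pi> \<gamma> x k) + \<beta> ^ m * U m + \<delta> * (\<Sum>k<m. \<beta> ^ k)" if "m \<le> N" for m
    using that
  proof (induction m)
    case (Suc m)
    have "\<beta> ^ m * U m \<le> \<beta> ^ m * (expected_cost \<pi> \<gamma> x m + \<beta> * U (Suc m) + \<delta>)"
      using Suc.prems beta_pos by (intro mult_left_mono step) auto
    then show ?case
      using Suc by (simp add: algebra_simps)
  qed simp
  from this[of N] \<open>\<delta> * (\<Sum>k<N. \<beta> ^ k) \<le> \<epsilon>\<close>
  have "U 0 \<le> (\<Sum>k<N. \<beta> ^ k * expected_cost \<pi> \<gamma> x k) + \<epsilon>"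
    by (simp add: U_def) (simp add: real_tail_value_def tail_value_end)
  then show ?thesis
    using integral_law_0[OF \<pi> \<gamma> x real_tail_value_measurable[OF \<pi>], of N 0] \<gamma>
    by (intro bexI[of _ \<gamma>]) (auto simp: U_def)
qed

lemma finite_policy_value_eq_SUP:
  assumes \<pi>: "\<pi> \<in> markov_policies E A D" and x: "x \<in> E"
  shows "finite_policy_value \<rho> c T Z \<beta> N \<pi> x =
    (SUP \<gamma>\<in>\<Gamma>. ereal (\<integral>X. discounted_cost c \<beta> (enat N) \<pi> X \<partial>law \<pi> \<gamma> x))" (is "_ = ?S")
proof -
  have "ereal (real_tail_value \<pi> N 0 x) = ?S"
  proof (rule antisym)
    show "ereal (real_tail_value \<pi> N 0 x) \<le> ?S"
    proof (rule ereal_le_epsilon2)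
      fix e :: real assume "0 < e"
      then obtain \<gamma> where \<gamma>: "\<gamma> \<in> \<Gamma>"
        "real_tail_value \<pi> N 0 x \<le> (\<Sum>k<N. \<beta> ^ k * expected_cost \<pi> \<gamma> x k) + e"
        using almost_optimal_nature[OF \<pi> x] by blast
      then have "ereal (real_tail_value \<pi> N 0 x) \<le>
          ereal (\<integral>X. discounted_cost c \<beta> (enat N) \<pi> X \<partial>law \<pi> \<gamma> x) + ereal e"
        by (simp add: expected_finite_discounted_cost[OF \<pi> _ x])
      also have "\<dots> \<le> ?S + ereal e"
        by (intro add_right_mono SUP_upper \<gamma>)
      finally show "ereal (real_tail_value \<pi> N 0 x) \<le> ?S + ereal e" .
    qed
    show "?S \<le> ereal (real_tail_value \<pi> N 0 x)"
      by (intro SUP_least)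
        (simp add: expected_finite_discounted_cost[OF \<pi> _ x] expected_cost_le_value[OF \<pi> _ x])
  qed
  then show ?thesis
    using tail_value_bound[OF \<pi> _ x, of 0 N] by (simp add: tail_value_0)
qed

section \<open>Passage to the infinite horizon\<close>

text \<open>The k-th discounted cost has expected absolute value at most (\<alpha> \<beta>)^k b(x).
  Summing this geometric bound from \<open>N\<close> on gives an estimate that does not involve
  \<open>\<gamma>\<close>.\<close>

lemma discounted_cost_tail:
  assumes \<pi>: "\<pi> \<in> markov_policies E A D" and \<gamma>: "\<gamma> \<in> \<Gamma>" and x: "x \<in> E"
  shows "\<bar>(\<integral>X. discounted_cost c \<beta> \<infinity> \<pi> X \<partial>law \<pi> \<gamma> x) -
      (\<integral>X. discounted_cost c \<beta> (enat N) \<pi> X \<partial>law \<pi> \<gamma> x)\<bar> \<le> (\<alpha> * \<beta>) ^ N * (value_bound * b x)"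
proof -
  let ?P = "law \<pi> \<gamma> x"
  let ?f = "\<lambda>k X. \<beta> ^ k * c (X k) (\<pi> k (X k)) (X (Suc k))"
  let ?a = "\<lambda>k. \<beta> ^ k * expected_cost \<pi> \<gamma> x k"
  let ?r = "\<alpha> * \<beta>"
  have r: "norm ?r < 1" "0 \<le> ?r"
    using alpha_nonneg beta_pos contraction by auto
  have int: "integrable ?P (?f k)" for k
    using integrable_cost[OF \<pi> \<gamma> x] by simp
  have [measurable]: "(\<lambda>X. c (X k) (\<pi> k (X k)) (X (Suc k))) \<in> borel_measurable ?P" for k
    using integrable_cost[OF \<pi> \<gamma> x] by (rule borel_measurable_integrable)
  have norm_le: "(\<integral>X. norm (?f k X) \<partial>?P) \<le> ?r ^ k * b x" for k
  proof -
    have "(\<integral>X. norm (?f k X) \<partial>?P) = \<beta> ^ k * (\<integral>X. \<bar>c (X k) (\<pi> k (X k)) (X (Suc k))\<bar> \<partial>?P)"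
      using beta_pos by (simp add: abs_mult)
    also have "\<dots> \<le> \<beta> ^ k * (\<alpha> ^ k * b x)"
      using beta_pos by (intro mult_left_mono expected_abs_cost_le[OF \<pi> \<gamma> x]) auto
    finally show ?thesis
      by (simp add: power_mult_distrib mult_ac)
  qed
  have geo: "summable (\<lambda>k. ?r ^ k * b x)"
    using r by (intro summable_mult2 summable_geometric)
  have sum_norm: "summable (\<lambda>k. \<integral>X. norm (?f k X) \<partial>?P)"
    by (rule summable_comparison_test'[OF geo, of 0]) (use norm_le in auto)
  have "(\<integral>\<^sup>+X. (\<Sum>k. ennreal (norm (?f k X))) \<partial>?P) = (\<Sum>k. \<integral>\<^sup>+X. ennreal (norm (?f k X)) \<partial>?P)"
    by (intro nn_integral_suminf) measurable
  also have "\<dots> = (\<Sum>k. ennreal (\<integral>X. norm (?f k X) \<partial>?P))"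
    by (intro arg_cong[where f=suminf] ext nn_integral_eq_integral integrable_norm int) auto
  also have "\<dots> \<noteq> \<infinity>"
    unfolding infinity_ennreal_def by (rule ennreal_suminf_neq_top[OF sum_norm]) simp
  finally have fin: "(\<integral>\<^sup>+X. (\<Sum>k. ennreal (norm (?f k X))) \<partial>?P) \<noteq> \<infinity>" .
  \<comment> \<open>Tonelli: the expected sum of the absolute costs is finite, so almost every path
    has an absolutely convergent cost series. On the remaining null set the value of the series does
    not affect the integral.\<close>
  have "AE X in ?P. (\<Sum>k. ennreal (norm (?f k X))) \<noteq> \<infinity>"
    by (rule nn_integral_PInf_AE[OF _ fin]) measurable
  then have AE_sum: "AE X in ?P. summable (\<lambda>k. norm (?f k X))"
    by eventually_elim (rule summable_suminf_not_top, simp_all only: norm_ge_zero infinity_ennreal_def not_False_eq_True)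
  have a: "(\<integral>X. ?f k X \<partial>?P) = ?a k" for k
    by (simp add: expected_cost_def)
  have inf: "(\<integral>X. discounted_cost c \<beta> \<infinity> \<pi> X \<partial>?P) = (\<Sum>k. ?a k)"
    unfolding discounted_cost_def using integral_suminf[OF int AE_sum sum_norm] by (simp add: expected_cost_def)
  have a_le: "norm (?a k) \<le> ?r ^ k * b x" for k
    using integral_norm_bound[of ?P "?f k"] norm_le[of k] unfolding a by (rule order_trans)
  have a_sum: "summable ?a"
    by (rule summable_comparison_test'[OF geo, of 0]) (rule a_le)
  have "(\<Sum>k. ?a k) - (\<Sum>k<N. ?a k) = (\<Sum>k. ?a (k + N))"
    using suminf_minus_initial_segment[OF a_sum, of N] by simp
  moreover have "norm (\<Sum>k. ?a (k + N)) \<le> (\<Sum>k. ?r ^ N * (?r ^ k * b x))"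
  proof (rule norm_suminf_le)
    show "norm (?a (k + N)) \<le> ?r ^ N * (?r ^ k * b x)" for k
      using a_le[of "k + N"] by (simp add: power_add mult_ac)
    show "summable (\<lambda>k. ?r ^ N * (?r ^ k * b x))"
      using geo by (rule summable_mult)
  qed
  moreover have "(\<Sum>k. ?r ^ N * (?r ^ k * b x)) = ?r ^ N * (value_bound * b x)"
    using geo r by (simp only: suminf_mult suminf_mult2[symmetric] summable_geometric suminf_geometric value_bound_def)
  ultimately show ?thesis
    by (simp add: inf expected_finite_discounted_cost[OF \<pi> \<gamma> x])
qed

text \<open>The tail estimate is uniform in \<open>\<gamma>\<close>, so limit and supremum may be
  exchanged. Convergence is proved along the way, so \<open>lim\<close> denotes a true
  limit.\<close>

lemma infinite_policy_value_eq_SUP: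
  assumes \<pi>: "\<pi> \<in> markov_policies E A D" and x: "x \<in> E"
  shows "lim (\<lambda>n. finite_policy_value \<rho> c T Z \<beta> n \<pi> x) =
    (SUP \<gamma>\<in>\<Gamma>. ereal (\<integral>X. discounted_cost c \<beta> \<infinity> \<pi> X \<partial>law \<pi> \<gamma> x))" (is "_ = ?S")
proof (rule limI)
  let ?F = "\<lambda>N \<gamma>. \<integral>X. discounted_cost c \<beta> N \<pi> X \<partial>law \<pi> \<gamma> x"
  let ?v = "\<lambda>n. real_tail_value \<pi> n 0 x"
  let ?d = "\<lambda>n. (\<alpha> * \<beta>) ^ n * (value_bound * b x)"
  have v: "finite_policy_value \<rho> c T Z \<beta> n \<pi> x = ereal (?v n)" for n
    using tail_value_bound[OF \<pi> _ x, of 0 n] by (simp add: tail_value_0)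
  have sup: "ereal (?v n) = (SUP \<gamma>\<in>\<Gamma>. ereal (?F (enat n) \<gamma>))" for n
    using finite_policy_value_eq_SUP[OF \<pi> x] by (simp add: v)
  have close: "?F \<infinity> \<gamma> \<le> ?F (enat n) \<gamma> + ?d n" "?F (enat n) \<gamma> \<le> ?F \<infinity> \<gamma> + ?d n" if "\<gamma> \<in> \<Gamma>" for n \<gamma>
    using discounted_cost_tail[OF \<pi> that x, of n] by linarith+
  have upper: "?S \<le> ereal (?v n + ?d n)" for n
  proof (rule SUP_least)
    fix \<gamma> assume \<gamma>: "\<gamma> \<in> \<Gamma>"
    have "ereal (?F \<infinity> \<gamma>) \<le> ereal (?F (enat n) \<gamma>) + ereal (?d n)"
      using close(1)[OF \<gamma>] by simp
    also have "\<dots> \<le> ereal (?v n) + ereal (?d n)"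
      unfolding sup by (intro add_right_mono SUP_upper \<gamma>)
    finally show "ereal (?F \<infinity> \<gamma>) \<le> ereal (?v n + ?d n)"
      by simp
  qed
  have lower: "ereal (?v n) \<le> ?S + ereal (?d n)" for n
    unfolding sup
  proof (rule SUP_least)
    fix \<gamma> assume \<gamma>: "\<gamma> \<in> \<Gamma>"
    have "ereal (?F (enat n) \<gamma>) \<le> ereal (?F \<infinity> \<gamma>) + ereal (?d n)"
      using close(2)[OF \<gamma>] by simp
    also have "\<dots> \<le> ?S + ereal (?d n)"
      by (intro add_right_mono SUP_upper \<gamma>)
    finally show "ereal (?F (enat n) \<gamma>) \<le> ?S + ereal (?d n)" .
  qed
  \<comment> \<open>The two estimates with n = 0 enclose the supremum between finite
    numbers.\<close>
  obtain s where s: "?S = ereal s"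
    using upper[of 0] lower[of 0] by (cases ?S) auto
  have "?d \<longlonglongrightarrow> 0"
    using alpha_nonneg beta_pos contraction by (intro tendsto_mult_left_zero LIMSEQ_power_zero) auto
  moreover have "norm (?v n - s) \<le> ?d n" for n
    using upper[of n] lower[of n] unfolding s by (simp add: abs_le_iff)
  ultimately have "(\<lambda>n. ?v n - s) \<longlonglongrightarrow> 0"
    by (rule Lim_null_comparison[OF always_eventually[OF allI], rotated])
  then have "?v \<longlonglongrightarrow> s"
    by (rule LIM_zero_cancel)
  then show "(\<lambda>n. finite_policy_value \<rho> c T Z \<beta> n \<pi> x) \<longlonglongrightarrow> ?S"
    unfolding v s by simp
qed

lemma policy_value_eq_SUP:
  assumes "\<pi> \<in> markov_policies E A D" "x \<in> E"
  shows "policy_value \<rho> c T Z \<beta> N \<pi> x =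
    (SUP Q\<in>laws_of_motion E T Z \<Gamma> \<pi> x. ereal (\<integral>X. discounted_cost c \<beta> N \<pi> X \<partial>Q))"
  using finite_policy_value_eq_SUP[OF assms] infinite_policy_value_eq_SUP[OF assms]
  by (cases N) (simp_all add: policy_value_def laws_of_motion_def image_image)

end

section \<open>From the model hypotheses to the abstract decision model\<close>

theorem theorem6p1:
  fixes P1 :: "'w measure" and M :: "(nat \<Rightarrow> 'w) measure"
    and p :: real and q :: ereal
    and \<rho> :: "((nat \<Rightarrow> 'w) \<Rightarrow> real) \<Rightarrow> ereal" and \<Q> :: "(nat \<Rightarrow> 'w) measure set"
    and E :: "'e::polish_space set" and A :: "'a::polish_space set" and D :: "('e \<times> 'a) set"
    and MZ :: "'z measure" and Zs :: "nat \<Rightarrow> (nat \<Rightarrow> 'w) \<Rightarrow> 'z" and Z :: "(nat \<Rightarrow> 'w) \<Rightarrow> 'z"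
    and T :: "'e \<Rightarrow> 'a \<Rightarrow> 'z \<Rightarrow> 'e" and c :: "'e \<Rightarrow> 'a \<Rightarrow> 'e \<Rightarrow> real" and \<beta> :: real
    and \<alpha> \<epsilon>lo \<epsilon>up :: real and blo bup :: "'e \<Rightarrow> real"
    and N :: enat and x0 :: 'e
  assumes exponents: "1 \<le> p" "1 < q" "1 / ereal p + 1 / q = 1"
    and E_borel: "E \<in> sets borel" and A_borel: "A \<in> sets borel"
    and D_meas: "D \<in> sets borel" "D \<subseteq> E \<times> A"
    and D_graph: "\<exists>d \<in> restrict_space borel E \<rightarrow>\<^sub>M restrict_space borel A. \<forall>x\<in>E. (x, d x) \<in> D"
    and T_meas: "(\<lambda>((x, a), z). T x a z) \<in>
        restrict_space borel D \<Otimes>\<^sub>M MZ \<rightarrow>\<^sub>M restrict_space borel E"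
    and c_meas: "(\<lambda>((x, a), y). c x a y) \<in>
        borel_measurable (restrict_space borel D \<Otimes>\<^sub>M restrict_space borel E)"
    and beta: "0 < \<beta>" "\<beta> \<le> 1"
    and Zs_iid: "prob_space.indep_vars M (\<lambda>_. MZ) Zs {1..}"
        "\<And>m n. 1 \<le> m \<Longrightarrow> 1 \<le> n \<Longrightarrow> distr M MZ (Zs m) = distr M MZ (Zs n)"
    and Z_representative: "Z \<in> M \<rightarrow>\<^sub>M MZ" "\<And>n. 1 \<le> n \<Longrightarrow> distr M MZ Z = distr M MZ (Zs n)"
    and eps: "0 \<le> \<alpha>" "0 \<le> \<epsilon>lo" "0 \<le> \<epsilon>up" "\<epsilon>lo + \<epsilon>up = 1"
    and blo: "blo \<in> borel_measurable (restrict_space borel E)" "\<And>x. x \<in> E \<Longrightarrow> blo x \<le> - \<epsilon>lo"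
    and bup: "bup \<in> borel_measurable (restrict_space borel E)" "\<And>x. x \<in> E \<Longrightarrow> \<epsilon>up \<le> bup x"
    and bounds: "\<And>x a. (x, a) \<in> D \<Longrightarrow>
          \<rho> (\<lambda>\<omega>. max 0 (- c x a (T x a (Z \<omega>)))) \<le> ereal (- blo x) \<and>
          \<rho> (\<lambda>\<omega>. - blo (T x a (Z \<omega>))) \<le> ereal (- \<alpha> * blo x) \<and>
          \<rho> (\<lambda>\<omega>. max 0 (c x a (T x a (Z \<omega>)))) \<le> ereal (bup x) \<and>
          \<rho> (\<lambda>\<omega>. bup (T x a (Z \<omega>))) \<le> ereal (\<alpha> * bup x)"
    and local_bounds: "\<And>x' a'. (x', a') \<in> D \<Longrightarrow>
          \<exists>\<epsilon>>0. \<exists>\<Theta>1 \<in> borel_measurable MZ. \<exists>\<Theta>2 \<in> borel_measurable MZ.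
            (\<forall>z\<in>space MZ. 0 \<le> \<Theta>1 z \<and> 0 \<le> \<Theta>2 z) \<and>
            (\<lambda>\<omega>. \<Theta>1 (Z \<omega>)) \<in> Lp_space M (ereal p) \<and> (\<lambda>\<omega>. \<Theta>2 (Z \<omega>)) \<in> Lp_space M (ereal p) \<and>
            (\<forall>z\<in>space MZ. \<forall>(x, a) \<in> D \<inter> cball (x', a') \<epsilon>.
               \<bar>c x a (T x a z)\<bar> \<le> \<Theta>1 z \<and> bup (T x a z) - blo (T x a z) \<le> \<Theta>2 z)"
    and rho: "rm_law_invariant M (ereal p) \<rho>" "rm_proper M (ereal p) \<rho>"
        "rm_coherent M (ereal p) \<rho>" "rm_fatou M (ereal p) \<rho>"
    and dual: "dual_representation M (ereal p) q \<rho> \<Q>"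
    and contraction: "\<alpha> * \<beta> < 1"
    and P1: "prob_space P1" "separable_measure P1"
    and M_product: "M = PiM {1..} (\<lambda>_. P1)"
    and Zs_coord: "\<And>n. 1 \<le> n \<Longrightarrow> \<exists>\<zeta> \<in> P1 \<rightarrow>\<^sub>M MZ. \<forall>\<omega>\<in>space M. Zs n \<omega> = \<zeta> (\<omega> n)"
    and values_meas: "\<And>\<pi> K. \<pi> \<in> markov_policies E A D \<Longrightarrow>
          policy_value \<rho> c T Z \<beta> K \<pi> \<in> borel_measurable (restrict_space borel E)"
    and x0: "x0 \<in> E"
  shows "optimal_value \<rho> c T Z \<beta> (markov_policies E A D) N x0 =
    (INF \<pi> \<in> markov_policies E A D.
       SUP Q \<in> laws_of_motion E T Z (nature_policies D (dual_borel M (ereal p) q \<Q>)) \<pi> x0.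
         ereal (\<integral>X. discounted_cost c \<beta> N \<pi> X \<partial>Q))"
proof -
  have prob_M: "prob_space M"
    unfolding M_product by (rule prob_space_PiM) (rule P1)
  interpret dual_risk_measure M p q \<rho> \<Q>
    using prob_M exponents dual by (simp add: dual_risk_measure_def dual_risk_measure_axioms_def)
  let ?B = "restrict_space borel E"
  let ?b = "\<lambda>x. bup x - blo x"
  have T_xa: "T x a \<in> MZ \<rightarrow>\<^sub>M ?B" if "(x, a) \<in> D" for x a
    using measurable_compose[OF measurable_Pair1'[of "(x, a)" "restrict_space borel D" MZ] T_meas] that
    by (simp add: space_restrict_space)
  have c_xa: "c x a \<in> borel_measurable ?B" if "(x, a) \<in> D" for x a
    using measurable_compose[OF measurable_Pair1'[of "(x, a)" "restrict_space borel D" ?B] c_meas] that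
    by (simp add: space_restrict_space)
  have bounds_sign: "blo x \<le> 0" "0 \<le> bup x" if "x \<in> E" for x
    using blo(2)[OF that] bup(2)[OF that] eps by auto
  have T_E: "T x a (Z \<omega>) \<in> E" if "(x, a) \<in> D" "\<omega> \<in> space M" for x a \<omega>
    using measurable_space[OF T_xa[OF that(1)] measurable_space[OF Z_representative(1) that(2)]]
    by (simp add: space_restrict_space)
  have Lp: "(\<lambda>\<omega>. c x a (T x a (Z \<omega>))) \<in> Lp_space M (ereal p)"
      "(\<lambda>\<omega>. ?b (T x a (Z \<omega>))) \<in> Lp_space M (ereal p)"
      "(\<lambda>\<omega>. bup (T x a (Z \<omega>))) \<in> Lp_space M (ereal p)"
      "(\<lambda>\<omega>. - blo (T x a (Z \<omega>))) \<in> Lp_space M (ereal p)"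
      "(\<lambda>\<omega>. max 0 (c x a (T x a (Z \<omega>)))) \<in> Lp_space M (ereal p)"
      "(\<lambda>\<omega>. max 0 (- c x a (T x a (Z \<omega>)))) \<in> Lp_space M (ereal p)"
    if xa: "(x, a) \<in> D" for x a
  proof -
    note [measurable] = T_xa[OF xa] c_xa[OF xa] blo(1) bup(1) Z_representative(1)
    obtain \<epsilon> \<Theta>1 \<Theta>2 where \<Theta>: "0 < \<epsilon>"
        "(\<lambda>\<omega>. \<Theta>1 (Z \<omega>)) \<in> Lp_space M (ereal p)" "(\<lambda>\<omega>. \<Theta>2 (Z \<omega>)) \<in> Lp_space M (ereal p)"
        "\<forall>z\<in>space MZ. \<forall>(x', a') \<in> D \<inter> cball (x, a) \<epsilon>.
           \<bar>c x' a' (T x' a' z)\<bar> \<le> \<Theta>1 z \<and> bup (T x' a' z) - blo (T x' a' z) \<le> \<Theta>2 z"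
      using local_bounds[OF xa] by blast
    \<comment> \<open>The local bounds are evaluated at the centre of their ball.\<close>
    have mem: "(x, a) \<in> D \<inter> cball (x, a) \<epsilon>"
      using xa \<Theta>(1) by simp
    have le: "\<bar>c x a (T x a (Z \<omega>))\<bar> \<le> \<bar>\<Theta>1 (Z \<omega>)\<bar>" "?b (T x a (Z \<omega>)) \<le> \<bar>\<Theta>2 (Z \<omega>)\<bar>"
      if "\<omega> \<in> space M" for \<omega>
      using bspec[OF bspec[OF \<Theta>(4) measurable_space[OF Z_representative(1) that]] mem]
      by (auto intro: order_trans[OF _ abs_ge_self])
    show c_Lp: "(\<lambda>\<omega>. c x a (T x a (Z \<omega>))) \<in> Lp_space M (ereal p)"
      by (rule Lp_space_dominated[OF \<Theta>(2) p_nonneg]) (measurable, rule le(1))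
    show b_Lp: "(\<lambda>\<omega>. ?b (T x a (Z \<omega>))) \<in> Lp_space M (ereal p)"
    proof (rule Lp_space_dominated[OF \<Theta>(3) p_nonneg])
      fix \<omega> assume "\<omega> \<in> space M"
      from le(2)[OF this] bounds_sign[OF T_E[OF xa this]]
      show "\<bar>?b (T x a (Z \<omega>))\<bar> \<le> \<bar>\<Theta>2 (Z \<omega>)\<bar>"
        by linarith
    qed measurable
    \<comment> \<open>From blo \<le> 0 \<le> bup, both \<open>bup\<close> and \<open>- blo\<close>
      lie between 0 and their sum.\<close>
    show "(\<lambda>\<omega>. bup (T x a (Z \<omega>))) \<in> Lp_space M (ereal p)"
        "(\<lambda>\<omega>. - blo (T x a (Z \<omega>))) \<in> Lp_space M (ereal p)"
    proof (safe intro!: Lp_space_dominated[OF b_Lp p_nonneg])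
      fix \<omega> assume "\<omega> \<in> space M"
      from bounds_sign[OF T_E[OF xa this]]
      show "\<bar>bup (T x a (Z \<omega>))\<bar> \<le> \<bar>?b (T x a (Z \<omega>))\<bar>" "\<bar>- blo (T x a (Z \<omega>))\<bar> \<le> \<bar>?b (T x a (Z \<omega>))\<bar>"
        by linarith+
    qed measurable
    show "(\<lambda>\<omega>. max 0 (c x a (T x a (Z \<omega>)))) \<in> Lp_space M (ereal p)"
        "(\<lambda>\<omega>. max 0 (- c x a (T x a (Z \<omega>)))) \<in> Lp_space M (ereal p)"
      by (auto intro!: Lp_space_dominated[OF c_Lp p_nonneg])
  qed
  have le_of_rho: "(\<integral>\<omega>. X \<omega> \<partial>Q) \<le> r"
    if "Q \<in> \<Q>" "X \<in> Lp_space M (ereal p)" "\<rho> X \<le> ereal r" for Q X r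
    using order_trans[OF integral_le_rho[OF that(1,2)] that(3)] by simp
  have Z_separable: "separable_measure (distr M MZ Z)"
  proof -
    \<comment> \<open>Only the law of \<open>Z\<close> matters. It equals the law of
      \<open>Zs 1\<close>, which depends on the first coordinate alone and is therefore the image of
      \<open>P1\<close> under \<open>\<zeta>\<close>.\<close>
    obtain \<zeta> where \<zeta>: "\<zeta> \<in> P1 \<rightarrow>\<^sub>M MZ" "\<forall>\<omega>\<in>space M. Zs 1 \<omega> = \<zeta> (\<omega> 1)"
      using Zs_coord[OF order_refl] by blast
    have component: "(\<lambda>\<omega>. \<omega> (1::nat)) \<in> M \<rightarrow>\<^sub>M P1"
      unfolding M_product by simp
    have "distr M MZ Z = distr M MZ (\<lambda>\<omega>. \<zeta> (\<omega> 1))"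
      unfolding Z_representative(2)[OF order_refl] by (rule distr_cong[OF refl refl]) (rule bspec[OF \<zeta>(2)])
    also have "\<dots> = distr (distr M P1 (\<lambda>\<omega>. \<omega> 1)) MZ \<zeta>"
      using distr_distr[OF \<zeta>(1) component] by (simp add: comp_def)
    also have "distr M P1 (\<lambda>\<omega>. \<omega> 1) = P1"
      unfolding M_product by (rule distr_PiM_component) (use P1(1) in auto)
    finally show ?thesis
      using separable_measure_distr[OF P1 \<zeta>(1)] by simp
  qed
  interpret risk_decision_model M p q \<rho> \<Q> E A D MZ Z T c ?b \<alpha> \<beta>
  proof unfold_locales
    show "?b \<in> borel_measurable ?B"
      using bup(1) blo(1) by measurable
    show "0 \<le> ?b x" if "x \<in> E" for x
      using bounds_sign[OF that] by simp
    fix x a Q assume xa: "(x, a) \<in> D" and Q: "Q \<in> \<Q>"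
    note Lp = Lp[OF xa] and bounds = bounds[OF xa]
    note int = dual_set_integrable[OF Q]
    \<comment> \<open>Splitting |c| into its two parts makes their separate risk bounds
      \<open>bup x\<close> and \<open>- blo x\<close> add up to the weight.\<close>
    have "(\<integral>\<omega>. \<bar>c x a (T x a (Z \<omega>))\<bar> \<partial>Q) =
        (\<integral>\<omega>. max 0 (c x a (T x a (Z \<omega>))) + max 0 (- c x a (T x a (Z \<omega>))) \<partial>Q)"
      by (intro Bochner_Integration.integral_cong) auto
    also have "\<dots> = (\<integral>\<omega>. max 0 (c x a (T x a (Z \<omega>))) \<partial>Q) + (\<integral>\<omega>. max 0 (- c x a (T x a (Z \<omega>))) \<partial>Q)"
      by (intro Bochner_Integration.integral_add int Lp)
    also have "\<dots> \<le> bup x + - blo x"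
      using bounds by (intro add_mono le_of_rho[OF Q] Lp) auto
    finally show "(\<integral>\<omega>. \<bar>c x a (T x a (Z \<omega>))\<bar> \<partial>Q) \<le> ?b x"
      by simp
    have "(\<integral>\<omega>. ?b (T x a (Z \<omega>)) \<partial>Q) = (\<integral>\<omega>. bup (T x a (Z \<omega>)) + - blo (T x a (Z \<omega>)) \<partial>Q)"
      by simp
    also have "\<dots> = (\<integral>\<omega>. bup (T x a (Z \<omega>)) \<partial>Q) + (\<integral>\<omega>. - blo (T x a (Z \<omega>)) \<partial>Q)"
      by (intro Bochner_Integration.integral_add int Lp)
    also have "\<dots> \<le> \<alpha> * bup x + - \<alpha> * blo x"
      using bounds by (intro add_mono le_of_rho[OF Q] Lp) auto
    finally show "(\<integral>\<omega>. ?b (T x a (Z \<omega>)) \<partial>Q) \<le> \<alpha> * ?b x"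
      by (simp add: algebra_simps)
  next
    show "finite_policy_value \<rho> c T Z \<beta> n \<pi> \<in> borel_measurable ?B"
      if "\<pi> \<in> markov_policies E A D" for \<pi> n
      using values_meas[OF that, of "enat n"] by (simp add: policy_value_def[abs_def])
  qed (use T_meas c_meas Z_representative Z_separable eps beta contraction Lp in auto)
  show ?thesis
    unfolding optimal_value_def using x0 by (intro INF_cong refl policy_value_eq_SUP)
qed

end
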